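(* The central operad of the category of sets (with its cartesian closed symmetric monoidal structure) is the operad $\mathbf{Perm}$; that is, the endomorphism operad $\mathscr{E}(\mathrm{id}_{\mathsf{Set}})$ of the identity functor $\mathrm{id}:\mathsf{Set}\to\mathsf{Set}$ is isomorphic to $\mathbf{Perm}$.
   Context: Operads are symmetric operads in sets, with arity $0$ allowed. Endomorphism operad: for a functor $F:\mathcal D\to \mathsf{Set}$, the endomorphism operad $\mathscr{E}(F)$ has arity $n$ component $\mathscr{E}(F)(n)=\mathrm{Nat}(F^{\times n},F)$, the set of natural transformations $F^{\times n}\to F$, where $F^{\times n}(d)=F(d)^{\times n}$. The symmetric group acts by permuting the inputs and the operad structure is induced by composition. The central operad of a closed symmetric monoidal category is the endomorphism operad of its identity functor. $\mathbf{Perm}$ is the operad in sets whose algebras are sets endowed with a binary operation $(x,y)\mapsto xy$ satisfying $(xy)z=x(yz)=x(zy)$. *)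

theory Defs
  imports
    "HOL-Library.FuncSet"
    "HOL-Library.Equipollence"
    "HOL-Combinatorics.Permutations"
begin

section \<open>Symmetric operads in sets\<close>

text \<open>
  The second argument of the composition lists the inserted operations together with their
  arities, because the same element may occur in several arities. Inputs are numbered from 0.
  The symmetric groups act from the left; on operations on a set this is
  $(\sigma\cdot f)(x_0,\dots,x_{n-1}) = f(x_{\sigma 0},\dots,x_{\sigma (n-1)})$. The usual
  right action is recovered by inverting $\sigma$.
\<close>

record 'a operad =
  ops :: "nat \<Rightarrow> 'a set"
  op_unit :: 'a
  op_comp :: "'a \<Rightarrow> (nat \<times> 'a) list \<Rightarrow> 'a"
  op_act :: "nat \<Rightarrow> (nat \<Rightarrow> nat) \<Rightarrow> 'a \<Rightarrow> 'a"

definition op_args :: "'a operad \<Rightarrow> (nat \<times> 'a) list \<Rightarrow> bool" where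
  "op_args P ys \<longleftrightarrow> (\<forall>(n, y) \<in> set ys. y \<in> ops P n)"

definition arity_sum :: "(nat \<times> 'a) list \<Rightarrow> nat" where
  "arity_sum ys = sum_list (map fst ys)"

text \<open>In a composite, input \<open>j\<close> of the \<open>i\<close>-th inserted operation gets number
  \<open>offset (map fst ys) i + j\<close>.\<close>

definition offset :: "nat list \<Rightarrow> nat \<Rightarrow> nat" where
  "offset ns i = sum_list (take i ns)"

text \<open>
  In the two equivariance axioms the block permutation and the direct sum of permutations are
  described by the condition on \<open>\<beta>\<close>, which determines \<open>\<beta>\<close> uniquely.
\<close>

locale symmetric_operad =
  fixes P :: "'a operad"
  assumes unit_closed: "op_unit P \<in> ops P 1"
    and comp_closed: "\<lbrakk>x \<in> ops P (length ys); op_args P ys\<rbrakk>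
      \<Longrightarrow> op_comp P x ys \<in> ops P (arity_sum ys)"
    and act_closed: "\<lbrakk>\<sigma> permutes {..<n}; x \<in> ops P n\<rbrakk> \<Longrightarrow> op_act P n \<sigma> x \<in> ops P n"
    and act_id: "x \<in> ops P n \<Longrightarrow> op_act P n id x = x"
    and act_comp: "\<lbrakk>\<sigma> permutes {..<n}; \<tau> permutes {..<n}; x \<in> ops P n\<rbrakk>
      \<Longrightarrow> op_act P n \<sigma> (op_act P n \<tau> x) = op_act P n (\<sigma> \<circ> \<tau>) x"
    and unit_left: "x \<in> ops P n \<Longrightarrow> op_comp P (op_unit P) [(n, x)] = x"
    and unit_right: "x \<in> ops P n \<Longrightarrow> op_comp P x (replicate n (1, op_unit P)) = x"
    and comp_assoc: "\<lbrakk>x \<in> ops P (length ys); op_args P ys; length zss = length ys;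
        \<And>i. i < length ys \<Longrightarrow> length (zss ! i) = fst (ys ! i) \<and> op_args P (zss ! i)\<rbrakk>
      \<Longrightarrow> op_comp P (op_comp P x ys) (concat zss) =
          op_comp P x (map2 (\<lambda>(n, y) zs. (arity_sum zs, op_comp P y zs)) ys zss)"
    and equivariant_outer: "\<lbrakk>x \<in> ops P (length ys); op_args P ys;
        \<sigma> permutes {..<length ys}; zs = permute_list \<sigma> ys; \<beta> permutes {..<arity_sum ys};
        \<And>i j. \<lbrakk>i < length ys; j < fst (zs ! i)\<rbrakk>
          \<Longrightarrow> \<beta> (offset (map fst zs) i + j) = offset (map fst ys) (\<sigma> i) + j\<rbrakk>
      \<Longrightarrow> op_comp P (op_act P (length ys) \<sigma> x) ys = op_act P (arity_sum ys) \<beta> (op_comp P x zs)"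
    and equivariant_inner: "\<lbrakk>x \<in> ops P (length ys); op_args P ys;
        \<And>i. i < length ys \<Longrightarrow> \<theta> i permutes {..<fst (ys ! i)};
        \<beta> permutes {..<arity_sum ys};
        \<And>i j. \<lbrakk>i < length ys; j < fst (ys ! i)\<rbrakk>
          \<Longrightarrow> \<beta> (offset (map fst ys) i + j) = offset (map fst ys) i + \<theta> i j\<rbrakk>
      \<Longrightarrow> op_comp P x (map (\<lambda>i. (fst (ys ! i), op_act P (fst (ys ! i)) (\<theta> i) (snd (ys ! i))))
            [0..<length ys])
          = op_act P (arity_sum ys) \<beta> (op_comp P x ys)"

definition operad_hom :: "'a operad \<Rightarrow> 'b operad \<Rightarrow> (nat \<Rightarrow> 'a \<Rightarrow> 'b) \<Rightarrow> bool" where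
  "operad_hom P Q \<phi> \<longleftrightarrow>
     (\<forall>n. \<forall>x \<in> ops P n. \<phi> n x \<in> ops Q n) \<and>
     \<phi> 1 (op_unit P) = op_unit Q \<and>
     (\<forall>x ys. x \<in> ops P (length ys) \<and> op_args P ys \<longrightarrow>
        \<phi> (arity_sum ys) (op_comp P x ys) =
          op_comp Q (\<phi> (length ys) x) (map (\<lambda>(n, y). (n, \<phi> n y)) ys)) \<and>
     (\<forall>n \<sigma>. \<forall>x \<in> ops P n. \<sigma> permutes {..<n} \<longrightarrow>
        \<phi> n (op_act P n \<sigma> x) = op_act Q n \<sigma> (\<phi> n x))"

definition isomorphic_operads :: "'a operad \<Rightarrow> 'b operad \<Rightarrow> bool" where
  "isomorphic_operads P Q \<longleftrightarrow>
     symmetric_operad P \<and> symmetric_operad Q \<and>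
     (\<exists>\<phi>. operad_hom P Q \<phi> \<and> (\<forall>n. bij_betw (\<phi> n) (ops P n) (ops Q n)))"


section \<open>Categories, functors and the category of sets\<close>

text \<open>Hom-sets need not be disjoint; composition and functors therefore take the objects as
  arguments.\<close>

record ('o, 'm) cat =
  Ob :: "'o set"
  Hom :: "'o \<Rightarrow> 'o \<Rightarrow> 'm set"
  Ident :: "'o \<Rightarrow> 'm"
  Comp :: "'o \<Rightarrow> 'o \<Rightarrow> 'o \<Rightarrow> 'm \<Rightarrow> 'm \<Rightarrow> 'm"  \<comment> \<open>\<open>Comp a b c g f\<close> for \<open>f: a \<rightarrow> b\<close>, \<open>g: b \<rightarrow> c\<close>\<close>

locale is_category =
  fixes C :: "('o, 'm) cat"
  assumes ident_in: "a \<in> Ob C \<Longrightarrow> Ident C a \<in> Hom C a a"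
    and comp_in: "\<lbrakk>a \<in> Ob C; b \<in> Ob C; c \<in> Ob C; f \<in> Hom C a b; g \<in> Hom C b c\<rbrakk>
      \<Longrightarrow> Comp C a b c g f \<in> Hom C a c"
    and ident_left: "\<lbrakk>a \<in> Ob C; b \<in> Ob C; f \<in> Hom C a b\<rbrakk> \<Longrightarrow> Comp C a b b (Ident C b) f = f"
    and ident_right: "\<lbrakk>a \<in> Ob C; b \<in> Ob C; f \<in> Hom C a b\<rbrakk> \<Longrightarrow> Comp C a a b f (Ident C a) = f"
    and comp_assoc: "\<lbrakk>a \<in> Ob C; b \<in> Ob C; c \<in> Ob C; d \<in> Ob C;
        f \<in> Hom C a b; g \<in> Hom C b c; h \<in> Hom C c d\<rbrakk>
      \<Longrightarrow> Comp C a b d (Comp C b c d h g) f = Comp C a c d h (Comp C a b c g f)"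

record ('o, 'm, 'p, 'n) func =
  fob :: "'o \<Rightarrow> 'p"
  farr :: "'o \<Rightarrow> 'o \<Rightarrow> 'm \<Rightarrow> 'n"

locale is_functor = source: is_category C + target: is_category D
  for C :: "('o, 'm) cat" and D :: "('p, 'n) cat" +
  fixes F :: "('o, 'm, 'p, 'n) func"
  assumes fob_in: "a \<in> Ob C \<Longrightarrow> fob F a \<in> Ob D"
    and farr_in: "\<lbrakk>a \<in> Ob C; b \<in> Ob C; f \<in> Hom C a b\<rbrakk>
      \<Longrightarrow> farr F a b f \<in> Hom D (fob F a) (fob F b)"
    and farr_ident: "a \<in> Ob C \<Longrightarrow> farr F a a (Ident C a) = Ident D (fob F a)"
    and farr_comp: "\<lbrakk>a \<in> Ob C; b \<in> Ob C; c \<in> Ob C; f \<in> Hom C a b; g \<in> Hom C b c\<rbrakk>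
      \<Longrightarrow> farr F a c (Comp C a b c g f)
        = Comp D (fob F a) (fob F b) (fob F c) (farr F b c g) (farr F a b f)"

definition id_func :: "('o, 'm, 'o, 'm) func" where
  "id_func = \<lparr>fob = (\<lambda>a. a), farr = (\<lambda>a b f. f)\<rparr>"

lemma id_functor: "is_category C \<Longrightarrow> is_functor C C id_func"
  by (auto simp: is_functor_def is_functor_axioms_def id_func_def)

text \<open>
  There is no set of all sets in HOL. As usual, sets are taken relative to a universe: a
  collection \<open>U\<close> of (small) subsets of some type. Only the following closure properties are
  imposed, products being taken up to bijection. They hold for the small sets of any
  Grothendieck universe, for the collection of all subsets of an arbitrary infinite type, and for
  the finite sets. Closure under function sets is a further property that \<open>U\<close> may or may not have:
  the endomorphism operad of the identity functor does not refer to the internal hom.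
\<close>

definition set_universe :: "'u set set \<Rightarrow> bool" where
  "set_universe U \<longleftrightarrow>
     (\<forall>A \<in> U. \<forall>B. B \<subseteq> A \<longrightarrow> B \<in> U) \<and>
     (\<forall>A \<in> U. \<forall>B \<in> U. \<exists>C \<in> U. C \<approx> A \<times> B) \<and>
     (\<exists>A \<in> U. card A = 2)"

lemma set_universe_UNIV:
  assumes "infinite (UNIV :: 'u set)"
  shows "set_universe (UNIV :: 'u set set)"
proof -
  have "\<exists>C :: 'u set. C \<approx> A \<times> B" for A B :: "'u set"
  proof -
    have "(card_of ((UNIV :: 'u set) \<times> (UNIV :: 'u set)), card_of (UNIV :: 'u set)) \<in> ordIso"
      using assms by (rule card_of_Times_same_infinite)
    then obtain g :: "'u \<times> 'u \<Rightarrow> 'u" where "bij_betw g (UNIV \<times> UNIV) UNIV"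
      unfolding card_of_ordIso[symmetric] by blast
    then have "inj_on g (A \<times> B)"
      by (metis bij_betw_imp_inj_on inj_on_subset Sigma_mono subset_UNIV)
    then have "g ` (A \<times> B) \<approx> A \<times> B"
      by (simp add: inj_on_image_eqpoll_self)
    then show ?thesis by blast
  qed
  moreover have "\<exists>A :: 'u set. card A = 2"
    using infinite_arbitrarily_large[OF assms, of 2] by blast
  ultimately show ?thesis
    by (simp add: set_universe_def)
qed

lemma set_universe_finite: "set_universe {A :: nat set. finite A}"
proof -
  have "\<exists>C :: nat set. finite C \<and> C \<approx> A \<times> B" if "finite A" "finite B" for A B :: "nat set"
    using that finite_cartesian_product[OF that]
    by (metis eqpoll_iff_card eqpoll_sym finite_lessThan card_lessThan)
  moreover have "\<exists>A :: nat set. finite A \<and> card A = 2"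
    by (rule exI[of _ "{0, 1}"]) simp
  ultimately show ?thesis
    by (auto simp: set_universe_def intro: finite_subset)
qed

definition set_cat :: "'u set set \<Rightarrow> ('u set, 'u \<Rightarrow> 'u) cat" where
  "set_cat U = \<lparr>Ob = U, Hom = (\<lambda>A B. A \<rightarrow>\<^sub>E B), Ident = (\<lambda>A. \<lambda>x\<in>A. x),
     Comp = (\<lambda>A B C g f. compose A g f)\<rparr>"

lemma set_cat_category: "is_category (set_cat U)"
  by unfold_locales
    (auto simp: set_cat_def compose_def PiE_def Pi_def extensional_def restrict_def fun_eq_iff)


section \<open>Endomorphism operads\<close>

text \<open>The \<open>n\<close>-th power of a set, with \<open>n\<close>-tuples as lists.\<close>

definition tuples :: "nat \<Rightarrow> 'u set \<Rightarrow> 'u list set" where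
  "tuples n A = {xs. length xs = n \<and> set xs \<subseteq> A}"

text \<open>Natural transformations from the \<open>n\<close>-th power of \<open>F\<close> to \<open>F\<close>, where \<open>F\<close> is a set-valued functor
  on \<open>D\<close>. Components are extensional, so that equal transformations are equal in HOL.\<close>

definition power_nat_transfs ::
    "('o, 'm) cat \<Rightarrow> ('o, 'm, 'u set, 'u \<Rightarrow> 'u) func \<Rightarrow> nat \<Rightarrow> ('o \<Rightarrow> 'u list \<Rightarrow> 'u) set" where
  "power_nat_transfs D F n =
     {\<alpha> \<in> (\<Pi>\<^sub>E d \<in> Ob D. tuples n (fob F d) \<rightarrow>\<^sub>E fob F d).
        \<forall>d \<in> Ob D. \<forall>e \<in> Ob D. \<forall>f \<in> Hom D d e. \<forall>xs \<in> tuples n (fob F d).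
          \<alpha> e (map (farr F d e f) xs) = farr F d e f (\<alpha> d xs)}"

text \<open>The \<open>i\<close>-th block of a tuple cut into consecutive blocks of lengths \<open>ns\<close>.\<close>

definition block :: "nat list \<Rightarrow> nat \<Rightarrow> 'u list \<Rightarrow> 'u list" where
  "block ns i xs = take (ns ! i) (drop (offset ns i) xs)"

definition endo_operad ::
    "('o, 'm) cat \<Rightarrow> ('o, 'm, 'u set, 'u \<Rightarrow> 'u) func \<Rightarrow> ('o \<Rightarrow> 'u list \<Rightarrow> 'u) operad" where
  "endo_operad D F =
     \<lparr>ops = power_nat_transfs D F,
      op_unit = (\<lambda>d \<in> Ob D. \<lambda>xs \<in> tuples 1 (fob F d). hd xs),
      op_comp = (\<lambda>\<alpha> \<beta>s. \<lambda>d \<in> Ob D. \<lambda>xs \<in> tuples (arity_sum \<beta>s) (fob F d).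
        \<alpha> d (map (\<lambda>i. snd (\<beta>s ! i) d (block (map fst \<beta>s) i xs)) [0..<length \<beta>s])),
      op_act = (\<lambda>n \<sigma> \<alpha>. \<lambda>d \<in> Ob D. \<lambda>xs \<in> tuples n (fob F d). \<alpha> d (permute_list \<sigma> xs))\<rparr>"

definition central_operad_Set :: "'u set set \<Rightarrow> ('u set \<Rightarrow> 'u list \<Rightarrow> 'u) operad" where
  "central_operad_Set U = endo_operad (set_cat U) id_func"


section \<open>The operad Perm\<close>

text \<open>
  Perm is presented by one binary generator and the relations $(xy)z = x(yz) = x(zy)$. The free
  operad on a binary generator consists in arity \<open>n\<close> of the binary trees whose leaves are labelled
  bijectively by the \<open>n\<close> inputs. The relations do not change the set of leaves of a tree, so the
  operadic congruence they generate is the restriction of the congruence below on all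
  (not necessarily multilinear) trees. That the algebras are the intended ones is lemma
  \<open>Perm_algebras\<close> at the end.
\<close>

datatype 'a magma = Var 'a | Mul "'a magma" "'a magma"

primrec leaves :: "'a magma \<Rightarrow> 'a list" where
  "leaves (Var a) = [a]"
| "leaves (Mul s t) = leaves s @ leaves t"

primrec subst :: "('a \<Rightarrow> 'b magma) \<Rightarrow> 'a magma \<Rightarrow> 'b magma" where
  "subst f (Var a) = f a"
| "subst f (Mul s t) = Mul (subst f s) (subst f t)"

inductive perm_eq :: "'a magma \<Rightarrow> 'a magma \<Rightarrow> bool" where
  perm_refl: "perm_eq t t"
| perm_sym: "perm_eq s t \<Longrightarrow> perm_eq t s"
| perm_trans: "perm_eq s t \<Longrightarrow> perm_eq t u \<Longrightarrow> perm_eq s u"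
| perm_cong: "perm_eq s s' \<Longrightarrow> perm_eq t t' \<Longrightarrow> perm_eq (Mul s t) (Mul s' t')"
| perm_assoc: "perm_eq (Mul (Mul x y) z) (Mul x (Mul y z))"
| perm_comm: "perm_eq (Mul x (Mul y z)) (Mul x (Mul z y))"

definition perm_class :: "nat magma \<Rightarrow> nat magma set" where
  "perm_class t = {s. perm_eq t s}"

definition multilinear :: "nat \<Rightarrow> nat magma \<Rightarrow> bool" where
  "multilinear n t \<longleftrightarrow> distinct (leaves t) \<and> set (leaves t) = {..<n}"

text \<open>Operadic composition in the free operad: the tree \<open>ts ! i\<close> is grafted onto the leaf \<open>i\<close> of \<open>t\<close>,
  its inputs being renumbered.\<close>

definition graft :: "nat list \<Rightarrow> nat magma \<Rightarrow> nat magma list \<Rightarrow> nat magma" where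
  "graft ns t ts = subst (\<lambda>i. map_magma (\<lambda>j. offset ns i + j) (ts ! i)) t"

definition Perm :: "nat magma set operad" where
  "Perm =
     \<lparr>ops = (\<lambda>n. perm_class ` {t. multilinear n t}),
      op_unit = perm_class (Var 0),
      op_comp = (\<lambda>X Ys. \<Union>{perm_class (graft (map fst Ys) t ts) |t ts.
        t \<in> X \<and> list_all2 (\<in>) ts (map snd Ys)}),
      op_act = (\<lambda>n \<sigma> X. \<Union>t \<in> X. perm_class (map_magma \<sigma> t))\<rparr>"


subsection \<open>Algebras over Perm\<close>

text \<open>An algebra structure on a set \<open>A\<close> is a morphism to the endomorphism operad of \<open>A\<close>, that is, of the
  functor from the one-object category selecting \<open>A\<close>.\<close>

definition point_cat :: "(unit, unit) cat" where
  "point_cat = \<lparr>Ob = UNIV, Hom = (\<lambda>_ _. UNIV), Ident = (\<lambda>_. ()), Comp = (\<lambda>_ _ _ _ _. ())\<rparr>"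

definition point_func :: "'u set \<Rightarrow> (unit, unit, 'u set, 'u \<Rightarrow> 'u) func" where
  "point_func A = \<lparr>fob = (\<lambda>_. A), farr = (\<lambda>_ _ _. \<lambda>x\<in>A. x)\<rparr>"

definition algebra_on :: "'a operad \<Rightarrow> 'u set \<Rightarrow> (nat \<Rightarrow> 'a \<Rightarrow> unit \<Rightarrow> 'u list \<Rightarrow> 'u) \<Rightarrow> bool" where
  "algebra_on P A \<theta> \<longleftrightarrow> operad_hom P (endo_operad point_cat (point_func A)) \<theta>"

definition perm_law :: "'u set \<Rightarrow> ('u \<Rightarrow> 'u \<Rightarrow> 'u) \<Rightarrow> bool" where
  "perm_law A m \<longleftrightarrow>
     (\<forall>x \<in> A. \<forall>y \<in> A. m x y \<in> A) \<and>
     (\<forall>x \<in> A. \<forall>y \<in> A. \<forall>z \<in> A. m (m x y) z = m x (m y z) \<and> m x (m y z) = m x (m z y))"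

definition perm_generator :: "nat magma set" where
  "perm_generator = perm_class (Mul (Var 0) (Var 1))"

definition induced_mult :: "(nat \<Rightarrow> nat magma set \<Rightarrow> unit \<Rightarrow> 'u list \<Rightarrow> 'u) \<Rightarrow> 'u \<Rightarrow> 'u \<Rightarrow> 'u" where
  "induced_mult \<theta> x y = \<theta> 2 perm_generator () [x, y]"

lemma operad_hom_comp:
  "\<lbrakk>operad_hom P Q \<phi>; length ys = k; arity_sum ys = n; x \<in> ops P k; op_args P ys\<rbrakk>
    \<Longrightarrow> \<phi> n (op_comp P x ys) = op_comp Q (\<phi> k x) (map (\<lambda>(n, y). (n, \<phi> n y)) ys)"
  unfolding operad_hom_def by blast

lemma operad_hom_act:
  "\<lbrakk>operad_hom P Q \<phi>; x \<in> ops P n; \<sigma> permutes {..<n}\<rbrakk>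
    \<Longrightarrow> \<phi> n (op_act P n \<sigma> x) = op_act Q n \<sigma> (\<phi> n x)"
  unfolding operad_hom_def by blast

lemma perm_class_eq: "perm_class s = perm_class t \<longleftrightarrow> perm_eq s t"
  unfolding perm_class_def using perm_refl perm_sym perm_trans by blast

lemma perm_class_self: "t \<in> perm_class t"
  by (simp add: perm_class_def perm_refl)

lemma perm_eq_mset: "perm_eq s t \<Longrightarrow> mset (leaves s) = mset (leaves t)"
  by (induction rule: perm_eq.induct) auto

lemma perm_eq_map: "perm_eq s t \<Longrightarrow> perm_eq (map_magma f s) (map_magma f t)"
  by (induction rule: perm_eq.induct) (auto intro: perm_eq.intros)

lemma perm_eq_subst: "perm_eq s t \<Longrightarrow> perm_eq (subst f s) (subst f t)"
  by (induction rule: perm_eq.induct) (auto intro: perm_eq.intros)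

lemma perm_eq_subst': "(\<And>i. i \<in> set (leaves t) \<Longrightarrow> perm_eq (f i) (g i)) \<Longrightarrow>
    perm_eq (subst f t) (subst g t)"
  by (induction t) (auto intro: perm_eq.intros)

lemma leaves_map: "leaves (map_magma f t) = map f (leaves t)"
  by (induction t) auto

lemma perm_eq_multilinear: "perm_eq s t \<Longrightarrow> multilinear n s \<longleftrightarrow> multilinear n t"
  unfolding multilinear_def using perm_eq_mset
  by (metis mset_eq_setD mset_eq_imp_distinct_iff)

lemma Perm_act: "op_act Perm n \<sigma> (perm_class t) = perm_class (map_magma \<sigma> t)"
proof -
  have eq: "perm_class (map_magma \<sigma> s) = perm_class (map_magma \<sigma> t)" if "s \<in> perm_class t" for s
    using that by (subst perm_class_eq) (simp add: perm_class_def perm_eq_map perm_sym)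
  have "op_act Perm n \<sigma> (perm_class t) = (\<Union>s \<in> perm_class t. perm_class (map_magma \<sigma> s))"
    by (simp add: Perm_def)
  also have "\<dots> = (\<Union>s \<in> perm_class t. perm_class (map_magma \<sigma> t))"
    by (rule SUP_cong[OF refl]) (rule eq)
  also have "\<dots> = perm_class (map_magma \<sigma> t)"
    using perm_class_self[of t] by blast
  finally show ?thesis .
qed

lemma Perm_comp:
  assumes "multilinear k t" "length ns = k" "length ts = k"
  shows "op_comp Perm (perm_class t) (zip ns (map perm_class ts)) = perm_class (graft ns t ts)"
proof -
  let ?Ys = "zip ns (map perm_class ts)"
  have Ys: "map fst ?Ys = ns" "map snd ?Ys = map perm_class ts"
    using assms by simp_all
  have eq: "perm_class (graft ns s ss) = perm_class (graft ns t ts)"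
    if "s \<in> perm_class t" "list_all2 (\<in>) ss (map perm_class ts)" for s ss
  proof -
    have ts: "perm_eq t s"
      using that by (simp add: perm_class_def)
    have "perm_eq (ts ! i) (ss ! i)" if "i < k" for i
      using list_all2_nthD2[OF \<open>list_all2 (\<in>) ss _\<close>, of i] that assms by (simp add: perm_class_def)
    then have "perm_eq (graft ns s ts) (graft ns s ss)"
      using assms perm_eq_multilinear[OF ts, of k]
      by (auto simp: graft_def multilinear_def intro!: perm_eq_subst' perm_eq_map)
    moreover have "perm_eq (graft ns t ts) (graft ns s ts)"
      using ts by (simp add: graft_def perm_eq_subst)
    ultimately show ?thesis
      using perm_class_eq perm_trans perm_sym by blast
  qed
  have "list_all2 (\<in>) ts (map perm_class ts)"
    by (simp add: list_all2_conv_all_nth perm_class_self)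
  then have "perm_class (graft ns t ts) \<in> {perm_class (graft ns s ss) |s ss.
      s \<in> perm_class t \<and> list_all2 (\<in>) ss (map perm_class ts)}"
    using perm_class_self by blast
  with eq have "{perm_class (graft ns s ss) |s ss.
      s \<in> perm_class t \<and> list_all2 (\<in>) ss (map perm_class ts)} = {perm_class (graft ns t ts)}"
    by auto
  then show ?thesis
    unfolding Perm_def by (simp add: Ys)
qed

lemma ops_Perm: "X \<in> ops Perm n \<longleftrightarrow> (\<exists>t. X = perm_class t \<and> multilinear n t)"
  by (auto simp: Perm_def)

text \<open>Relabelling the leaves from left to right.\<close>

primrec standardize :: "'a magma \<Rightarrow> nat magma" where
  "standardize (Var a) = Var 0"
| "standardize (Mul s t) = Mul (standardize s)
     (map_magma (\<lambda>j. length (leaves s) + j) (standardize t))"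

lemma leaves_standardize: "leaves (standardize t) = [0..<length (leaves t)]"
proof (induction t)
  case (Mul s t)
  have "map (\<lambda>j. length (leaves s) + j) [0..<length (leaves t)]
    = [length (leaves s)..<length (leaves s) + length (leaves t)]"
    by (rule nth_equalityI) auto
  then show ?case
    using Mul upt_add_eq_append[of 0 "length (leaves s)" "length (leaves t)"]
    by (simp add: leaves_map)
qed simp

lemma multilinear_standardize: "multilinear (length (leaves t)) (standardize t)"
  by (auto simp: multilinear_def leaves_standardize)

lemma map_magma_cong_leaves:
  "(\<And>i. i \<in> set (leaves t) \<Longrightarrow> f i = g i) \<Longrightarrow> map_magma f t = map_magma g t"
  by (induction t) auto

lemma map_magma_comp: "map_magma f (map_magma g t) = map_magma (\<lambda>x. f (g x)) t"
  by (induction t) auto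

lemma map_standardize: "map_magma (\<lambda>i. leaves t ! i) (standardize t) = t"
proof (induction t)
  case (Mul s t)
  have "map_magma (\<lambda>i. (leaves s @ leaves t) ! i) (standardize s)
      = map_magma (\<lambda>i. leaves s ! i) (standardize s)"
    by (rule map_magma_cong_leaves) (simp add: leaves_standardize nth_append)
  with Mul show ?case
    by (simp add: map_magma_comp)
qed simp

lemma multilinear_length: "multilinear n t \<Longrightarrow> length (leaves t) = n"
  by (metis card_lessThan distinct_card multilinear_def)

lemma standardize_act:
  assumes "multilinear n t"
  obtains \<sigma> where "\<sigma> permutes {..<n}" "t = map_magma \<sigma> (standardize t)"
proof
  let ?\<sigma> = "\<lambda>i. if i < n then leaves t ! i else i"
  have n: "length (leaves t) = n"
    using assms by (rule multilinear_length)
  show "?\<sigma> permutes {..<n}"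
  proof (rule bij_imp_permutes)
    have "bij_betw (\<lambda>i. leaves t ! i) {..<n} {..<n}"
      by (rule bij_betw_nth) (use assms n in \<open>simp_all add: multilinear_def\<close>)
    moreover have "bij_betw ?\<sigma> {..<n} {..<n} = bij_betw (\<lambda>i. leaves t ! i) {..<n} {..<n}"
      by (rule bij_betw_cong) simp
    ultimately show "bij_betw ?\<sigma> {..<n} {..<n}"
      by simp
  qed auto
  show "t = map_magma ?\<sigma> (standardize t)"
  proof -
    have "map_magma ?\<sigma> (standardize t) = map_magma (\<lambda>i. leaves t ! i) (standardize t)"
      by (rule map_magma_cong_leaves) (simp add: leaves_standardize n)
    then show ?thesis
      by (simp only: map_standardize)
  qed
qed

lemma multilinear_generator: "multilinear 2 (Mul (Var 0) (Var 1))"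
  by (simp add: multilinear_def numeral_2_eq_2 lessThan_Suc insert_commute)

lemma standardize_comp:
  "perm_class (standardize (Mul s t)) = op_comp Perm perm_generator
     [(length (leaves s), perm_class (standardize s)), (length (leaves t), perm_class (standardize t))]"
proof -
  let ?ns = "[length (leaves s), length (leaves t)]" and ?ts = "[standardize s, standardize t]"
  have "op_comp Perm perm_generator (zip ?ns (map perm_class ?ts))
      = perm_class (graft ?ns (Mul (Var 0) (Var 1)) ?ts)"
    unfolding perm_generator_def by (rule Perm_comp[OF multilinear_generator]) simp_all
  moreover have "(+) (0::nat) = (\<lambda>j. j)"
    by auto
  ultimately show ?thesis
    by (simp add: graft_def offset_def magma.map_ident)
qed

lemma endo_set_ops: "ops (endo_operad point_cat (point_func A)) n
    = {\<alpha>. \<alpha> () \<in> tuples n A \<rightarrow>\<^sub>E A}"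
proof -
  have "map (\<lambda>x\<in>A. x) xs = xs" if "xs \<in> tuples n A" for xs
    using that by (intro map_idI) (auto simp: tuples_def)
  then show ?thesis
    by (auto simp: endo_operad_def power_nat_transfs_def point_cat_def point_func_def PiE_iff
        dest!: PiE_mem)
qed

lemma Perm_algebra_determined:
  assumes "algebra_on Perm A \<theta>" "algebra_on Perm A \<theta>'"
    and gen: "\<And>x y. x \<in> A \<Longrightarrow> y \<in> A \<Longrightarrow> induced_mult \<theta> x y = induced_mult \<theta>' x y"
    and "X \<in> ops Perm n"
  shows "\<theta> n X = \<theta>' n X"
proof -
  let ?E = "endo_operad point_cat (point_func A)"
  have hom: "operad_hom Perm ?E \<theta>" "operad_hom Perm ?E \<theta>'"
    using assms by (auto simp: algebra_on_def)
  have gen_in: "perm_generator \<in> ops Perm 2"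
    using multilinear_generator by (auto simp: ops_Perm perm_generator_def)
  have gen_eq: "\<theta> 2 perm_generator = \<theta>' 2 perm_generator"
  proof -
    have "\<theta> 2 perm_generator () \<in> tuples 2 A \<rightarrow>\<^sub>E A" "\<theta>' 2 perm_generator () \<in> tuples 2 A \<rightarrow>\<^sub>E A"
      using hom gen_in unfolding operad_hom_def endo_set_ops by blast+
    moreover have "\<theta> 2 perm_generator () xs = \<theta>' 2 perm_generator () xs" if "xs \<in> tuples 2 A" for xs
    proof -
      have "\<exists>x y. xs = [x, y] \<and> x \<in> A \<and> y \<in> A"
        using that by (cases xs; cases "tl xs") (auto simp: tuples_def)
      then show ?thesis
        using gen by (auto simp: induced_mult_def)
    qed
    ultimately have "\<theta> 2 perm_generator () = \<theta>' 2 perm_generator ()"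
      by (rule PiE_ext)
    then show ?thesis
      by (simp add: fun_eq_iff)
  qed
  have std: "\<theta> (length (leaves t)) (perm_class (standardize t))
      = \<theta>' (length (leaves t)) (perm_class (standardize t))" for t :: "nat magma"
  proof (induction t)
    case (Var a)
    have "perm_class (Var 0) = op_unit Perm"
      by (simp add: Perm_def)
    then show ?case
      using hom by (simp add: operad_hom_def)
  next
    case (Mul s t)
    let ?ys = "[(length (leaves s), perm_class (standardize s)),
      (length (leaves t), perm_class (standardize t))]"
    have ys: "op_args Perm ?ys" "arity_sum ?ys = length (leaves (Mul s t))" "length ?ys = 2"
      using multilinear_standardize by (auto simp: op_args_def ops_Perm arity_sum_def)
    have "\<phi> (length (leaves (Mul s t))) (perm_class (standardize (Mul s t))) =
        op_comp ?E (\<phi> 2 perm_generator) (map (\<lambda>(n, y). (n, \<phi> n y)) ?ys)"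
      if "operad_hom Perm ?E \<phi>" for \<phi>
      unfolding standardize_comp by (rule operad_hom_comp[OF that ys(3,2) gen_in ys(1)])
    then show ?case
      using hom gen_eq Mul by simp
  qed
  obtain t where t: "X = perm_class t" "multilinear n t"
    using assms ops_Perm by blast
  then obtain \<sigma> where \<sigma>: "\<sigma> permutes {..<n}" "t = map_magma \<sigma> (standardize t)"
    using standardize_act by blast
  have X: "X = op_act Perm n \<sigma> (perm_class (standardize t))"
    using t \<sigma> by (simp add: Perm_act)
  have n: "length (leaves t) = n"
    using t multilinear_length by blast
  then have "perm_class (standardize t) \<in> ops Perm n"
    using multilinear_standardize[of t] by (auto simp: ops_Perm)
  then have "\<phi> n X = op_act ?E n \<sigma> (\<phi> n (perm_class (standardize t)))"
    if "operad_hom Perm ?E \<phi>" for \<phi>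
    unfolding X by (rule operad_hom_act[OF that _ \<sigma>(1)])
  then show ?thesis
    using hom std[of t] n by simp
qed

lemma Perm_algebra_law:
  assumes "algebra_on Perm A \<theta>"
  shows "perm_law A (induced_mult \<theta>)"
proof -
  let ?E = "endo_operad point_cat (point_func A)"
  let ?g = "Mul (Var 0) (Var 1) :: nat magma" and ?v = "Var 0 :: nat magma"
  have hom: "operad_hom Perm ?E \<theta>"
    using assms by (auto simp: algebra_on_def)
  have gen_in: "perm_generator \<in> ops Perm 2"
    using multilinear_generator by (auto simp: ops_Perm perm_generator_def)
  have unit_in: "perm_class ?v \<in> ops Perm 1"
    by (auto simp: ops_Perm multilinear_def)
  have unit: "\<theta> 1 (perm_class ?v) () [x] = x" if "x \<in> A" for x
  proof -
    have "\<theta> 1 (perm_class ?v) = op_unit ?E"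
      using hom by (simp add: operad_hom_def Perm_def)
    then show ?thesis
      using that by (simp add: endo_operad_def point_cat_def point_func_def tuples_def)
  qed
  have closed: "induced_mult \<theta> x y \<in> A" if "x \<in> A" "y \<in> A" for x y
  proof -
    have "\<theta> 2 perm_generator () \<in> tuples 2 A \<rightarrow>\<^sub>E A"
      using hom gen_in unfolding operad_hom_def endo_set_ops by blast
    then show ?thesis
      using that by (auto simp: induced_mult_def tuples_def)
  qed
  have comp: "\<theta> (a + b) (op_comp Perm perm_generator [(a, X), (b, Y)]) () (xs @ ys)
      = induced_mult \<theta> (\<theta> a X () xs) (\<theta> b Y () ys)"
    if "X \<in> ops Perm a" "Y \<in> ops Perm b" "xs \<in> tuples a A" "ys \<in> tuples b A" for a b X Y xs ys
  proof -
    let ?ys = "[(a, X), (b, Y)]"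
    have ys: "op_args Perm ?ys" "arity_sum ?ys = a + b" "length ?ys = 2"
      using that by (auto simp: op_args_def arity_sum_def)
    then have "\<theta> (a + b) (op_comp Perm perm_generator ?ys) =
        op_comp ?E (\<theta> 2 perm_generator) (map (\<lambda>(n, y). (n, \<theta> n y)) ?ys)"
      by (intro operad_hom_comp[OF hom ys(3,2) gen_in ys(1)])
    then show ?thesis
      using that by (auto simp: endo_operad_def point_cat_def point_func_def arity_sum_def
          tuples_def induced_mult_def block_def offset_def)
  qed
  have left: "op_comp Perm perm_generator [(2, perm_generator), (1, perm_class ?v)]
      = perm_class (Mul ?g (Var 2))"
    using Perm_comp[OF multilinear_generator, of "[2, 1]" "[?g, ?v]"]
    by (simp add: graft_def offset_def perm_generator_def)
  have right: "op_comp Perm perm_generator [(1, perm_class ?v), (2, perm_generator)]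
      = perm_class (Mul (Var 0) (Mul (Var 1) (Var 2)))"
    using Perm_comp[OF multilinear_generator, of "[1, 2]" "[?v, ?g]"]
    by (simp add: graft_def offset_def perm_generator_def numeral_2_eq_2)
  let ?R = "perm_class (Mul (Var 0) (Mul (Var 1) (Var 2)))"
  have assoc: "perm_class (Mul ?g (Var 2)) = ?R"
    by (simp add: perm_class_eq perm_assoc)
  define \<tau> where "\<tau> = transpose (1::nat) 2"
  have \<tau>: "\<tau> permutes {..<3}"
    unfolding \<tau>_def by (rule permutes_swap_id) auto
  have "op_act Perm 3 \<tau> ?R = perm_class (Mul (Var 0) (Mul (Var 2) (Var 1)))"
    unfolding Perm_act by (simp add: \<tau>_def transpose_def)
  also have "\<dots> = ?R"
    by (simp add: perm_class_eq perm_comm)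
  finally have act: "op_act Perm 3 \<tau> ?R = ?R" .
  have R_in: "?R \<in> ops Perm 3"
    unfolding ops_Perm by (rule exI, rule conjI, rule refl) (auto simp: multilinear_def)
  have three: "(1::nat) + 2 = 3" "(2::nat) + 1 = 3"
    by simp_all
  have R: "\<theta> 3 ?R () [x, y, z] = induced_mult \<theta> x (induced_mult \<theta> y z)"
    if "x \<in> A" "y \<in> A" "z \<in> A" for x y z
  proof -
    have "[x] \<in> tuples 1 A" "[y, z] \<in> tuples 2 A"
      using that by (simp_all add: tuples_def)
    from comp[OF unit_in gen_in this] show ?thesis
      unfolding right unit[OF that(1)] three by (simp only: append.simps induced_mult_def)
  qed
  have L: "\<theta> 3 ?R () [x, y, z] = induced_mult \<theta> (induced_mult \<theta> x y) z"
    if "x \<in> A" "y \<in> A" "z \<in> A" for x y z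
  proof -
    have "[x, y] \<in> tuples 2 A" "[z] \<in> tuples 1 A"
      using that by (simp_all add: tuples_def)
    from comp[OF gen_in unit_in this] show ?thesis
      unfolding left assoc unit[OF that(3)] three by (simp only: append.simps induced_mult_def)
  qed
  have "\<theta> 3 ?R () [x, y, z] = \<theta> 3 ?R () [x, z, y]" if "x \<in> A" "y \<in> A" "z \<in> A" for x y z
  proof -
    have "\<theta> 3 ?R = op_act ?E 3 \<tau> (\<theta> 3 ?R)"
      using operad_hom_act[OF hom R_in \<tau>] act by simp
    then have "\<theta> 3 ?R () [x, y, z] = op_act ?E 3 \<tau> (\<theta> 3 ?R) () [x, y, z]"
      by simp
    also have "\<dots> = \<theta> 3 ?R () (permute_list \<tau> [x, y, z])"
      using that by (simp add: endo_operad_def point_cat_def point_func_def tuples_def)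
    also have "permute_list \<tau> [x, y, z] = [x, z, y]"
      by (simp add: permute_list_def \<tau>_def transpose_def upt_rec)
    finally show ?thesis .
  qed
  then show ?thesis
    unfolding perm_law_def using closed R L by metis
qed

primrec eval_magma :: "('u \<Rightarrow> 'u \<Rightarrow> 'u) \<Rightarrow> ('a \<Rightarrow> 'u) \<Rightarrow> 'a magma \<Rightarrow> 'u" where
  "eval_magma m v (Var a) = v a"
| "eval_magma m v (Mul s t) = m (eval_magma m v s) (eval_magma m v t)"

lemma eval_magma_in:
  assumes "perm_law A m"
  shows "v ` set (leaves t) \<subseteq> A \<Longrightarrow> eval_magma m v t \<in> A"
  using assms by (induction t) (auto simp: perm_law_def image_subset_iff)

lemma eval_magma_perm_eq:
  assumes "perm_law A m"
  shows "perm_eq s t \<Longrightarrow> v ` set (leaves s) \<subseteq> A \<Longrightarrow> eval_magma m v s = eval_magma m v t"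
proof (induction rule: perm_eq.induct)
  case (perm_sym s t)
  then show ?case
    by (metis perm_eq_mset mset_eq_setD)
next
  case (perm_trans s t u)
  then show ?case
    by (metis perm_eq_mset mset_eq_setD)
next
  case (perm_assoc x y z)
  then have "eval_magma m v x \<in> A" "eval_magma m v y \<in> A" "eval_magma m v z \<in> A"
    by (simp_all add: eval_magma_in[OF assms] image_Un)
  then show ?case
    using assms by (auto simp: perm_law_def)
next
  case (perm_comm x y z)
  then have "eval_magma m v x \<in> A" "eval_magma m v y \<in> A" "eval_magma m v z \<in> A"
    by (simp_all add: eval_magma_in[OF assms] image_Un)
  then show ?case
    using assms by (auto simp: perm_law_def)
qed (simp_all add: image_Un)

lemma eval_magma_subst: "eval_magma m v (subst f t) = eval_magma m (\<lambda>a. eval_magma m v (f a)) t"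
  by (induction t) auto

lemma eval_magma_map: "eval_magma m v (map_magma f t) = eval_magma m (\<lambda>a. v (f a)) t"
  by (induction t) auto

lemma eval_magma_cong:
  "(\<And>a. a \<in> set (leaves t) \<Longrightarrow> v a = w a) \<Longrightarrow> eval_magma m v t = eval_magma m w t"
  by (induction t) auto

lemma offset_bound:
  assumes "i < length ns" "j < ns ! i"
  shows "offset ns i + j < sum_list ns"
proof -
  have "sum_list ns = sum_list (take i ns) + sum_list (drop i ns)"
    by (metis append_take_drop_id sum_list_append)
  also have "drop i ns = ns ! i # drop (Suc i) ns"
    using assms by (simp add: Cons_nth_drop_Suc)
  finally show ?thesis
    using assms by (simp add: offset_def)
qed

lemma offset_length_block:
  assumes "length xs = sum_list ns" "i < length ns"
  shows "length (block ns i xs) = ns ! i"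
proof (cases "ns ! i")
  case (Suc k)
  then have "offset ns i + k < sum_list ns"
    using offset_bound[of i ns k] assms by simp
  then show ?thesis
    using assms Suc by (simp add: block_def)
qed (simp add: block_def)

lemma Perm_algebra_exists:
  assumes law: "perm_law A m"
  shows "\<exists>\<theta>. algebra_on Perm A \<theta> \<and> (\<forall>x \<in> A. \<forall>y \<in> A. induced_mult \<theta> x y = m x y)"
proof -
  let ?E = "endo_operad point_cat (point_func A)"
  define \<theta> :: "nat \<Rightarrow> nat magma set \<Rightarrow> unit \<Rightarrow> 'a list \<Rightarrow> 'a" where
    "\<theta> n X u = (\<lambda>xs \<in> tuples n A. eval_magma m ((!) xs) (SOME t. t \<in> X))" for n X u
  have eval: "\<theta> n (perm_class t) u xs = eval_magma m ((!) xs) t"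
    if "multilinear n t" "xs \<in> tuples n A" for n t u xs
  proof -
    have "(SOME s. s \<in> perm_class t) \<in> perm_class t"
      using perm_class_self by (rule someI)
    then have "perm_eq t (SOME s. s \<in> perm_class t)"
      by (simp add: perm_class_def)
    moreover have "(!) xs ` set (leaves t) \<subseteq> A"
      using that by (auto simp: multilinear_def tuples_def)
    ultimately show ?thesis
      using eval_magma_perm_eq[OF law] that by (metis \<theta>_def restrict_apply')
  qed
  have ops: "\<theta> n X \<in> ops ?E n" if "X \<in> ops Perm n" for n X
  proof -
    obtain t where t: "X = perm_class t" "multilinear n t"
      using \<open>X \<in> ops Perm n\<close> ops_Perm by blast
    have "eval_magma m ((!) xs) t \<in> A" if "xs \<in> tuples n A" for xs
      using that t by (intro eval_magma_in[OF law]) (auto simp: multilinear_def tuples_def)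
    with eval t show ?thesis
      by (auto simp: endo_set_ops PiE_iff extensional_def) (simp add: \<theta>_def)
  qed
  have ext: "\<alpha> = \<beta>" if "\<alpha> () \<in> extensional (tuples n A)" "\<beta> () \<in> extensional (tuples n A)"
    "\<And>xs. xs \<in> tuples n A \<Longrightarrow> \<alpha> () xs = \<beta> () xs" for \<alpha> \<beta> :: "unit \<Rightarrow> 'a list \<Rightarrow> 'a" and n
    using extensionalityI[of "\<alpha> ()" "tuples n A" "\<beta> ()"] that by (simp add: fun_eq_iff)
  have \<theta>_ext: "\<theta> n X u \<in> extensional (tuples n A)" for n X u
    by (simp add: \<theta>_def)
  have unit: "\<theta> 1 (op_unit Perm) = op_unit ?E"
  proof (rule ext[of _ 1])
    fix xs assume "xs \<in> tuples 1 A"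
    moreover have "multilinear 1 (Var 0)" "op_unit Perm = perm_class (Var 0)"
      by (auto simp: multilinear_def Perm_def)
    ultimately show "\<theta> 1 (op_unit Perm) () xs = op_unit ?E () xs"
      using eval[of 1 "Var 0" xs]
      by (cases xs) (auto simp: endo_operad_def point_cat_def point_func_def tuples_def)
  qed (auto simp: \<theta>_ext endo_operad_def point_cat_def point_func_def)
  have act: "\<theta> n (op_act Perm n \<sigma> X) = op_act ?E n \<sigma> (\<theta> n X)"
    if X: "X \<in> ops Perm n" and \<sigma>: "\<sigma> permutes {..<n}" for n \<sigma> X
  proof -
    obtain t where t: "X = perm_class t" "multilinear n t"
      using X ops_Perm by blast
    have mt: "multilinear n (map_magma \<sigma> t)"
      using t \<sigma> by (auto simp: multilinear_def leaves_map distinct_map permutes_image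
          intro: inj_on_subset[OF permutes_inj])
    show ?thesis
    proof (rule ext[of _ n])
      fix xs assume xs: "xs \<in> tuples n A"
      have p: "permute_list \<sigma> xs \<in> tuples n A"
        using xs \<sigma> by (auto simp: tuples_def)
      have "eval_magma m (\<lambda>a. xs ! \<sigma> a) t = eval_magma m ((!) (permute_list \<sigma> xs)) t"
        using t \<sigma> xs by (intro eval_magma_cong)
          (auto simp: multilinear_def tuples_def permute_list_nth)
      then show "\<theta> n (op_act Perm n \<sigma> X) () xs = op_act ?E n \<sigma> (\<theta> n X) () xs"
        using xs p t mt eval by (simp add: Perm_act eval_magma_map)
          (simp add: endo_operad_def point_cat_def point_func_def eval)
    qed (auto simp: \<theta>_ext endo_operad_def point_cat_def point_func_def)
  qed
  have comp: "\<theta> (arity_sum ys) (op_comp Perm X ys) =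
      op_comp ?E (\<theta> (length ys) X) (map (\<lambda>(n, y). (n, \<theta> n y)) ys)"
    if X: "X \<in> ops Perm (length ys)" and ys: "op_args Perm ys" for X ys
  proof -
    define k where "k = length ys"
    define ns where "ns = map fst ys"
    obtain t where t: "X = perm_class t" "multilinear k t"
      using X ops_Perm k_def by blast
    have "\<forall>i<k. \<exists>s. snd (ys ! i) = perm_class s \<and> multilinear (ns ! i) s"
      using ys by (auto simp: op_args_def k_def ns_def ops_Perm dest!: bspec[OF _ nth_mem])
    then obtain s where s: "\<And>i. i < k \<Longrightarrow> snd (ys ! i) = perm_class (s i)"
        "\<And>i. i < k \<Longrightarrow> multilinear (ns ! i) (s i)"
      by metis
    define ts where "ts = map s [0..<k]"
    have len: "length ns = k" "length ts = k"
      by (simp_all add: ns_def k_def ts_def)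
    have ys_zip: "ys = zip ns (map perm_class ts)"
      by (rule nth_equalityI) (auto simp: len k_def[symmetric] ts_def s(1)[symmetric] ns_def)
    have sum: "arity_sum ys = sum_list ns"
      by (simp add: arity_sum_def ns_def)
    have cl: "op_comp Perm X ys = perm_class (graft ns t ts)"
      unfolding t ys_zip by (rule Perm_comp) (use t len in auto)
    have inset: "offset ns i + j < sum_list ns" if "i < k" "j \<in> set (leaves (s i))" for i j
      using that s(2)[of i] offset_bound[of i ns j] len by (auto simp: multilinear_def)
    show ?thesis
    proof (rule ext[of _ "arity_sum ys"])
      fix xs assume xs: "xs \<in> tuples (arity_sum ys) A"
      have lxs: "length xs = sum_list ns"
        using xs sum by (simp add: tuples_def)
      have blk: "block ns i xs \<in> tuples (ns ! i) A" if "i < k" for i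
        using xs offset_length_block[OF lxs, of i] that len
        by (auto simp: tuples_def block_def dest: in_set_takeD in_set_dropD)
      have val: "eval_magma m ((!) xs) (map_magma (\<lambda>j. offset ns i + j) (ts ! i))
          = \<theta> (ns ! i) (snd (ys ! i)) () (block ns i xs)" if i: "i < k" for i
      proof -
        have "eval_magma m (\<lambda>j. xs ! (offset ns i + j)) (s i)
            = eval_magma m ((!) (block ns i xs)) (s i)"
        proof (rule eval_magma_cong)
          fix j assume "j \<in> set (leaves (s i))"
          then have "j < ns ! i" "offset ns i + j < length xs"
            using s(2)[OF i] inset[OF i] lxs by (auto simp: multilinear_def)
          then show "xs ! (offset ns i + j) = block ns i xs ! j"
            by (simp add: block_def)
        qed
        then show ?thesis
          using i blk[OF i] s eval by (simp add: eval_magma_map ts_def)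
      qed
      have valA: "\<theta> (ns ! i) (snd (ys ! i)) () (block ns i xs) \<in> A" if "i < k" for i
      proof -
        have "\<theta> (ns ! i) (snd (ys ! i)) \<in> ops ?E (ns ! i)"
          using that s by (intro ops) (auto simp: ops_Perm)
        then show ?thesis
          using blk[OF that] by (auto simp: endo_set_ops)
      qed
      have inA: "(!) xs ` set (leaves (graft ns t ts)) \<subseteq> A"
      proof -
        have "set (leaves (subst f u)) = (\<Union>a \<in> set (leaves u). set (leaves (f a)))"
          for f :: "nat \<Rightarrow> nat magma" and u
          by (induction u) auto
        then have "set (leaves (graft ns t ts)) \<subseteq> {..<sum_list ns}"
          using t inset by (auto simp: graft_def leaves_map multilinear_def ts_def)
        then show ?thesis
          using xs lxs nth_mem unfolding tuples_def by fastforce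
      qed
      have "(SOME u. u \<in> perm_class (graft ns t ts)) \<in> perm_class (graft ns t ts)"
        using perm_class_self by (rule someI)
      then have "perm_eq (graft ns t ts) (SOME u. u \<in> perm_class (graft ns t ts))"
        by (simp add: perm_class_def)
      then have "\<theta> (arity_sum ys) (op_comp Perm X ys) () xs = eval_magma m ((!) xs) (graft ns t ts)"
        using eval_magma_perm_eq[OF law _ inA] xs cl by (simp add: \<theta>_def)
      also have "\<dots> = eval_magma m
          ((!) (map (\<lambda>i. \<theta> (ns ! i) (snd (ys ! i)) () (block ns i xs)) [0..<k])) t"
        unfolding graft_def eval_magma_subst using t val
        by (intro eval_magma_cong) (auto simp: multilinear_def)
      also have "\<dots> = \<theta> k X ()
          (map (\<lambda>i. \<theta> (ns ! i) (snd (ys ! i)) () (block ns i xs)) [0..<k])"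
        unfolding t by (rule eval[symmetric]) (use t valA in \<open>auto simp: tuples_def\<close>)
      also have "\<dots> = op_comp ?E (\<theta> (length ys) X) (map (\<lambda>(n, y). (n, \<theta> n y)) ys) () xs"
      proof -
        define zs where "zs = map (\<lambda>(n, y). (n, \<theta> n y)) ys"
        have zs: "map fst zs = ns" "length zs = k"
          by (auto simp: zs_def ns_def k_def)
        then have "xs \<in> tuples (arity_sum zs) A"
          using xs sum by (simp add: arity_sum_def)
        then have "op_comp ?E (\<theta> k X) zs () xs
            = \<theta> k X () (map (\<lambda>i. snd (zs ! i) () (block (map fst zs) i xs)) [0..<length zs])"
          by (simp add: endo_operad_def point_cat_def point_func_def)
        also have "\<dots> = \<theta> k X () (map (\<lambda>i. snd (zs ! i) () (block ns i xs)) [0..<k])"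
          unfolding zs ..
        also have "map (\<lambda>i. snd (zs ! i) () (block ns i xs)) [0..<k]
            = map (\<lambda>i. \<theta> (ns ! i) (snd (ys ! i)) () (block ns i xs)) [0..<k]"
          by (auto simp: k_def ns_def zs_def split: prod.splits)
        finally show ?thesis
          by (simp only: zs_def k_def)
      qed
      finally show "\<theta> (arity_sum ys) (op_comp Perm X ys) () xs =
          op_comp ?E (\<theta> (length ys) X) (map (\<lambda>(n, y). (n, \<theta> n y)) ys) () xs" .
    next
      have "arity_sum (map (\<lambda>(n, y). (n, \<theta> n y)) ys) = arity_sum ys"
        by (simp add: arity_sum_def comp_def case_prod_beta)
      then show "op_comp ?E (\<theta> (length ys) X) (map (\<lambda>(n, y). (n, \<theta> n y)) ys) ()
          \<in> extensional (tuples (arity_sum ys) A)"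
        by (simp add: endo_operad_def point_cat_def point_func_def)
    qed (simp add: \<theta>_ext)
  qed
  have "algebra_on Perm A \<theta>"
    unfolding algebra_on_def operad_hom_def using ops unit act comp by blast
  moreover have "induced_mult \<theta> x y = m x y" if "x \<in> A" "y \<in> A" for x y
    using eval[OF multilinear_generator, of "[x, y]"] that
    by (simp add: induced_mult_def perm_generator_def tuples_def)
  ultimately show ?thesis by blast
qed

text \<open>Evaluation at the generator identifies algebra structures over Perm on \<open>A\<close> with binary operations
  on \<open>A\<close> satisfying the laws.\<close>

lemma Perm_algebras:
  shows "algebra_on Perm A \<theta> \<Longrightarrow> perm_law A (induced_mult \<theta>)"
    and "perm_law A m \<Longrightarrow>
      \<exists>\<theta>. algebra_on Perm A \<theta> \<and> (\<forall>x \<in> A. \<forall>y \<in> A. induced_mult \<theta> x y = m x y)"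
    and "\<lbrakk>algebra_on Perm A \<theta>; algebra_on Perm A \<theta>';
        \<forall>x \<in> A. \<forall>y \<in> A. induced_mult \<theta> x y = induced_mult \<theta>' x y; X \<in> ops Perm n\<rbrakk>
      \<Longrightarrow> \<theta> n X = \<theta>' n X"
  by (fact Perm_algebra_law, fact Perm_algebra_exists, rule Perm_algebra_determined) auto

end

theory Submission
  imports Defs
begin

text \<open>
  Both operads are isomorphic to the operad of projections, which has the numbers \<open>k < n\<close> in arity
  \<open>n\<close>. Modulo the relations of Perm a tree is determined by its leftmost leaf and the multiset of
  its leaves. A natural operation on sets, applied to a tuple of distinct elements \<open>x\<^sub>0, \<dots>, x\<^bsub>n-1\<^esub>\<close> of
  a set, takes a value in the subset of these elements, hence a value \<open>x\<^sub>k\<close>; every other tuple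
  is an image of this one, so that the operation is the \<open>k\<close>-th projection everywhere.
\<close>

section \<open>Isomorphisms of operads\<close>

lemma arity_sum_concat: "arity_sum (concat yss) = sum_list (map arity_sum yss)"
  by (induction yss) (auto simp: arity_sum_def)

text \<open>All operations of \<open>P\<close>, and all lists of operations inserted in a composite,
  lift along \<psi>. Since \<psi> commutes with the structure maps, both sides of every axiom for
  \<open>P\<close> are images of the two sides of the same axiom for \<open>Q\<close>. In this way
  \<open>Perm\<close> and the central operad inherit the axioms.\<close>

lemma symmetric_operad_quotient:
  assumes Q: "symmetric_operad Q" and hom: "operad_hom Q P \<psi>"
    and surj: "\<And>n. \<psi> n ` ops Q n = ops P n"
  shows "symmetric_operad P"
proof -
  interpret Q: symmetric_operad Q by (fact Q)
  define M where "M = map (\<lambda>(n, y). (n, \<psi> n y))"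
  have closed: "\<psi> n x \<in> ops P n" if "x \<in> ops Q n" for n x
    using that surj by blast
  have unit: "\<psi> 1 (op_unit Q) = op_unit P"
    using hom by (simp add: operad_hom_def)
  \<comment> \<open>\<open>act\<close> and \<open>comp\<close> are the homomorphism equations read
    backwards: rewriting with them replaces structure of \<open>P\<close> on lifted arguments by
    \<psi> of structure of \<open>Q\<close>.\<close>
  have act: "op_act P n \<sigma> (\<psi> n x) = \<psi> n (op_act Q n \<sigma> x)"
    if "x \<in> ops Q n" "\<sigma> permutes {..<n}" for n \<sigma> x
    using operad_hom_act[OF hom that] by simp
  have comp: "op_comp P (\<psi> k x) (M ys) = \<psi> n (op_comp Q x ys)"
    if "k = length ys" "n = arity_sum ys" "x \<in> ops Q k" "op_args Q ys" for k n x ys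
    using operad_hom_comp[OF hom, of ys k n x] that by (simp add: M_def)
  have M_simps [simp]: "length (M ys) = length ys" "arity_sum (M ys) = arity_sum ys"
    "map fst (M ys) = map fst ys" for ys
    by (simp_all add: M_def arity_sum_def comp_def case_prod_beta)
  have M_nth [simp]: "fst (M ys ! i) = fst (ys ! i)"
      "snd (M ys ! i) = \<psi> (fst (ys ! i)) (snd (ys ! i))" if "i < length ys" for ys i
    using that by (simp_all add: M_def case_prod_beta)
  have lift: "\<exists>x' \<in> ops Q n. x = \<psi> n x'" if "x \<in> ops P n" for n x
    using that surj by blast
  have lift_args: "\<exists>ys'. op_args Q ys' \<and> ys = M ys'" if "op_args P ys" for ys
    using that
  proof (induction ys)
    case Nil
    then show ?case by (auto simp: op_args_def M_def)
  next
    case (Cons y ys)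
    obtain n y0 where y: "y = (n, y0)" by fastforce
    obtain y' where "y' \<in> ops Q n" "y0 = \<psi> n y'"
      using Cons.prems lift y by (auto simp: op_args_def)
    moreover obtain ys' where "op_args Q ys'" "ys = M ys'"
      using Cons by (auto simp: op_args_def)
    ultimately have "op_args Q ((n, y') # ys') \<and> y # ys = M ((n, y') # ys')"
      by (auto simp: op_args_def M_def y)
    then show ?case by blast
  qed
  have args_nth: "snd (ys ! i) \<in> ops Q (fst (ys ! i))" if "op_args Q ys" "i < length ys" for ys i
    using that by (auto simp: op_args_def dest!: nth_mem)
  show ?thesis
  proof
    show "op_unit P \<in> ops P 1"
      using closed Q.unit_closed unit by metis
  next
    fix x ys assume "x \<in> ops P (length ys)" "op_args P ys"
    then obtain x' ys' where "x' \<in> ops Q (length ys)" "x = \<psi> (length ys) x'"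
      "op_args Q ys'" "ys = M ys'"
      using lift lift_args by metis
    then show "op_comp P x ys \<in> ops P (arity_sum ys)"
      by (simp add: comp closed Q.comp_closed)
  next
    fix \<sigma> n x assume "\<sigma> permutes {..<n}" "x \<in> ops P n"
    then show "op_act P n \<sigma> x \<in> ops P n"
      using lift[of x n] by (auto simp: act closed Q.act_closed)
  next
    fix x n assume "x \<in> ops P n"
    then show "op_act P n id x = x"
      using lift[of x n] by (auto simp: act Q.act_id permutes_id)
  next
    fix \<sigma> \<tau> n x assume "\<sigma> permutes {..<n}" "\<tau> permutes {..<n}" "x \<in> ops P n"
    then show "op_act P n \<sigma> (op_act P n \<tau> x) = op_act P n (\<sigma> \<circ> \<tau>) x"
      using lift[of x n] by (auto simp: act Q.act_comp Q.act_closed permutes_compose)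
  next
    fix x n assume "x \<in> ops P n"
    then obtain x' where x: "x' \<in> ops Q n" "x = \<psi> n x'" using lift by blast
    have "op_comp P (\<psi> 1 (op_unit Q)) (M [(n, x')]) = \<psi> n (op_comp Q (op_unit Q) [(n, x')])"
      using x Q.unit_closed by (intro comp) (auto simp: arity_sum_def op_args_def)
    then show "op_comp P (op_unit P) [(n, x)] = x"
      using x unit by (simp add: M_def Q.unit_left)
  next
    fix x n assume "x \<in> ops P n"
    then obtain x' where x: "x' \<in> ops Q n" "x = \<psi> n x'" using lift by blast
    have "op_comp P (\<psi> n x') (M (replicate n (1, op_unit Q)))
        = \<psi> n (op_comp Q x' (replicate n (1, op_unit Q)))"
      using x Q.unit_closed
      by (intro comp) (auto simp: arity_sum_def op_args_def sum_list_replicate)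
    then show "op_comp P x (replicate n (1, op_unit P)) = x"
      using x unit Q.unit_right[OF x(1)] by (simp add: M_def)
  next
    fix x ys zss
    assume *: "x \<in> ops P (length ys)" "op_args P ys" "length zss = length ys"
      and zss: "\<And>i. i < length ys \<Longrightarrow> length (zss ! i) = fst (ys ! i) \<and> op_args P (zss ! i)"
    obtain x' ys' where x: "x' \<in> ops Q (length ys)" "x = \<psi> (length ys) x'"
      and ys: "op_args Q ys'" "ys = M ys'"
      using * lift lift_args by metis
    have "\<forall>i<length ys. \<exists>zs'. op_args Q zs' \<and> zss ! i = M zs'"
      using zss lift_args by blast
    then obtain z where z: "\<And>i. i < length ys \<Longrightarrow> op_args Q (z i) \<and> zss ! i = M (z i)"
      by metis
    define zss' where "zss' = map z [0..<length ys]"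
    have zss': "length zss' = length ys'" "zss = map M zss'"
      using z * ys by (auto simp: zss'_def intro: nth_equalityI)
    have zss'_nth: "length (zss' ! i) = fst (ys' ! i) \<and> op_args Q (zss' ! i)"
      if "i < length ys'" for i
      using that zss[of i] z[of i] ys by (simp add: zss'_def)
    have concat: "concat zss = M (concat zss')"
      by (simp add: zss' M_def map_concat)
    have args: "op_args Q (concat zss')"
      using zss' zss'_nth by (fastforce simp: op_args_def in_set_conv_nth)
    have len: "map length zss' = map fst ys'"
      using zss' zss'_nth by (auto intro: nth_equalityI)
    \<comment> \<open>Inserting \<open>concat zss'\<close> into the composite of \<open>x'\<close>
      and \<open>ys'\<close> requires as many operations as that composite has inputs.\<close>
    have "arity_sum ys' = length (concat zss')"
      by (simp add: arity_sum_def length_concat len)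
    moreover have "arity_sum (concat zss') = sum_list (map arity_sum zss')"
      by (rule arity_sum_concat)
    \<comment> \<open>\<open>ws\<close> lists the inner composites in \<open>Q\<close>. Once
      \<open>M ws\<close> is identified with the list of inner composites in \<open>P\<close>, the
      goal is \<psi> applied to associativity in \<open>Q\<close>.\<close>
    moreover define ws where "ws = map2 (\<lambda>(n, y) zs. (arity_sum zs, op_comp Q y zs)) ys' zss'"
    moreover have ws: "length ws = length ys'" "map fst ws = map arity_sum zss'"
      using zss' by (auto simp: ws_def case_prod_beta intro: nth_equalityI)
    moreover have arity_sum_ws: "arity_sum ws = sum_list (map arity_sum zss')"
      unfolding arity_sum_def[of ws] ws(2) ..
    moreover have wargs: "op_args Q ws"
    proof -
      have "snd (ws ! i) \<in> ops Q (fst (ws ! i))" if "i < length ws" for i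
        using that zss' ws(1) zss'_nth[of i] args_nth[OF ys(1), of i]
          Q.comp_closed[of "snd (ys' ! i)" "zss' ! i"]
        by (simp add: ws_def case_prod_beta)
      then show ?thesis
        by (auto simp: op_args_def in_set_conv_nth) (metis fst_conv snd_conv)
    qed
    moreover have "map2 (\<lambda>(n, y) zs. (arity_sum zs, op_comp P y zs)) ys zss = M ws"
    proof (rule nth_equalityI)
      fix i assume "i < length (map2 (\<lambda>(n, y) zs. (arity_sum zs, op_comp P y zs)) ys zss)"
      then have i: "i < length ys'" using ys zss' by simp
      have "op_comp P (\<psi> (fst (ys' ! i)) (snd (ys' ! i))) (M (zss' ! i))
          = \<psi> (arity_sum (zss' ! i)) (op_comp Q (snd (ys' ! i)) (zss' ! i))"
        using i zss'_nth args_nth[OF ys(1)] by (intro comp) auto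
      then show "map2 (\<lambda>(n, y) zs. (arity_sum zs, op_comp P y zs)) ys zss ! i = M ws ! i"
        using i ys zss' by (simp add: case_prod_beta ws_def prod_eq_iff)
    qed (use ys zss' ws in simp)
    moreover have "op_comp Q (op_comp Q x' ys') (concat zss') = op_comp Q x' ws"
      unfolding ws_def using x ys zss' zss'_nth by (intro Q.comp_assoc) auto
    ultimately show "op_comp P (op_comp P x ys) (concat zss) =
        op_comp P x (map2 (\<lambda>(n, y) zs. (arity_sum zs, op_comp P y zs)) ys zss)"
      using comp[of "arity_sum ys'" "concat zss'" "arity_sum ws" "op_comp Q x' ys'"]
        comp[of "length ys'" ys' "arity_sum ys'" x'] comp[of "length ys'" ws "arity_sum ws" x']
        x ys args concat Q.comp_closed[of x' ys'] by simp
  next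
    fix x ys \<sigma> zs \<beta>
    assume *: "x \<in> ops P (length ys)" "op_args P ys" and \<sigma>: "\<sigma> permutes {..<length ys}"
      and zs: "zs = permute_list \<sigma> ys" and \<beta>: "\<beta> permutes {..<arity_sum ys}"
      and eq: "\<And>i j. \<lbrakk>i < length ys; j < fst (zs ! i)\<rbrakk>
          \<Longrightarrow> \<beta> (offset (map fst zs) i + j) = offset (map fst ys) (\<sigma> i) + j"
    obtain x' ys' where x: "x' \<in> ops Q (length ys)" "x = \<psi> (length ys) x'"
      and ys: "op_args Q ys'" "ys = M ys'"
      using * lift lift_args by metis
    define zs' where "zs' = permute_list \<sigma> ys'"
    have \<sigma>': "\<sigma> permutes {..<length ys'}" using \<sigma> ys by simp
    have zs_M: "zs = M zs'"
      unfolding zs zs'_def ys(2) M_def by (rule permute_list_map[OF \<sigma>'])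
    have mset: "mset zs' = mset ys'"
      unfolding zs'_def by (rule mset_permute_list[OF \<sigma>'])
    have zs': "length zs' = length ys'" "op_args Q zs'" "arity_sum zs' = arity_sum ys'"
      using ys(1) mset_eq_setD[OF mset] mset_eq_length[OF mset]
        arg_cong[OF mset, of "\<lambda>m. sum_mset (image_mset fst m)"]
      by (simp_all add: op_args_def arity_sum_def sum_mset_sum_list flip: mset_map)
    \<comment> \<open>The condition on \<beta> mentions arities only, and \<open>M\<close> preserves
      these, so the same block permutation serves in \<open>Q\<close>.\<close>
    have "op_comp Q (op_act Q (length ys') \<sigma> x') ys' = op_act Q (arity_sum ys') \<beta> (op_comp Q x' zs')"
      by (rule Q.equivariant_outer[OF _ ys(1) \<sigma>' zs'_def])
        (use x ys \<beta> eq zs_M zs' in auto)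
    then show "op_comp P (op_act P (length ys) \<sigma> x) ys = op_act P (arity_sum ys) \<beta> (op_comp P x zs)"
      using x ys zs_M zs' \<sigma>' \<beta> Q.comp_closed[of x' zs']
      by (simp add: act comp Q.act_closed)
  next
    fix x ys \<theta> \<beta>
    assume *: "x \<in> ops P (length ys)" "op_args P ys"
      and \<theta>: "\<And>i. i < length ys \<Longrightarrow> \<theta> i permutes {..<fst (ys ! i)}"
      and \<beta>: "\<beta> permutes {..<arity_sum ys}"
      and eq: "\<And>i j. \<lbrakk>i < length ys; j < fst (ys ! i)\<rbrakk>
          \<Longrightarrow> \<beta> (offset (map fst ys) i + j) = offset (map fst ys) i + \<theta> i j"
    obtain x' ys' where x: "x' \<in> ops Q (length ys)" "x = \<psi> (length ys) x'"
      and ys: "op_args Q ys'" "ys = M ys'"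
      using * lift lift_args by metis
    define ws where "ws = map (\<lambda>i. (fst (ys' ! i),
      op_act Q (fst (ys' ! i)) (\<theta> i) (snd (ys' ! i)))) [0..<length ys']"
    have fst_ws: "map fst ws = map fst ys'"
      by (auto simp: ws_def intro: nth_equalityI)
    have ws: "length ws = length ys'" "op_args Q ws" "arity_sum ws = arity_sum ys'"
      using \<theta> ys args_nth[OF ys(1)] Q.act_closed fst_ws
      by (auto simp: ws_def op_args_def arity_sum_def)
    have "map (\<lambda>i. (fst (ys ! i), op_act P (fst (ys ! i)) (\<theta> i) (snd (ys ! i)))) [0..<length ys]
        = M ws"
      by (rule nth_equalityI)
        (use \<theta> ys args_nth[OF ys(1)] ws in \<open>auto simp: prod_eq_iff ws_def act\<close>)
    moreover have "op_comp Q x' ws = op_act Q (arity_sum ys') \<beta> (op_comp Q x' ys')"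
      unfolding ws_def by (rule Q.equivariant_inner[OF _ ys(1)])
        (use x ys \<beta> \<theta> eq in auto)
    ultimately show "op_comp P x
        (map (\<lambda>i. (fst (ys ! i), op_act P (fst (ys ! i)) (\<theta> i) (snd (ys ! i)))) [0..<length ys])
          = op_act P (arity_sum ys) \<beta> (op_comp P x ys)"
      using x ys ws \<beta> Q.comp_closed[of x' ys'] by (simp add: act comp)
  qed
qed

text \<open>An isomorphism demands the operad axioms on both sides; those of the target follow by
  transport along the surjections \<psi>.\<close>

lemma isomorphic_operads_bij:
  assumes "symmetric_operad Q" "operad_hom Q P \<psi>" "\<And>n. bij_betw (\<psi> n) (ops Q n) (ops P n)"
  shows "isomorphic_operads Q P"
  unfolding isomorphic_operads_def
  using assms symmetric_operad_quotient[OF assms(1,2)] bij_betw_imp_surj_on by blast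

lemma isomorphic_operads_sym:
  assumes "isomorphic_operads P Q"
  shows "isomorphic_operads Q P"
proof -
  obtain \<phi> where P: "symmetric_operad P" and Q: "symmetric_operad Q" and hom: "operad_hom P Q \<phi>"
    and bij: "\<And>n. bij_betw (\<phi> n) (ops P n) (ops Q n)"
    using assms by (auto simp: isomorphic_operads_def)
  interpret P: symmetric_operad P by (fact P)
  define \<psi> where "\<psi> n = inv_into (ops P n) (\<phi> n)" for n
  have closed: "\<psi> n y \<in> ops P n" and right: "\<phi> n (\<psi> n y) = y" if "y \<in> ops Q n" for n y
    using that bij unfolding \<psi>_def bij_betw_def by (metis inv_into_into f_inv_into_f)+
  have left: "\<psi> n (\<phi> n x) = x" if "x \<in> ops P n" for n x
    using that bij unfolding \<psi>_def bij_betw_def by simp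
  have "operad_hom Q P \<psi>"
    unfolding operad_hom_def
  proof (intro conjI allI ballI impI)
    show "\<psi> 1 (op_unit Q) = op_unit P"
      using left[OF P.unit_closed] hom by (simp add: operad_hom_def)
  next
    fix x ys assume a: "x \<in> ops Q (length ys) \<and> op_args Q ys"
    let ?zs = "map (\<lambda>(n, y). (n, \<psi> n y)) ys"
    have zs: "op_args P ?zs" "length ?zs = length ys" "arity_sum ?zs = arity_sum ys"
      using a closed by (auto simp: op_args_def arity_sum_def comp_def case_prod_beta)
    have "map (\<lambda>(n, y). (n, \<phi> n y)) ?zs = ys"
      using a right by (auto simp: op_args_def intro!: map_idI)
    \<comment> \<open>The compatibility of \<psi> with composition is verified after applying
      \<phi>, where it becomes that of \<phi>; then \<open>left\<close> cancels \<phi>.\<close>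
    then have "\<phi> (arity_sum ys) (op_comp P (\<psi> (length ys) x) ?zs) = op_comp Q x ys"
      using operad_hom_comp[OF hom zs(2,3) closed zs(1)] right a by simp
    then show "\<psi> (arity_sum ys) (op_comp Q x ys) = op_comp P (\<psi> (length ys) x) ?zs"
      using left[OF P.comp_closed[of "\<psi> (length ys) x" ?zs]] zs closed a by simp
  next
    fix n \<sigma> x assume "x \<in> ops Q n" "\<sigma> permutes {..<n}"
    then show "\<psi> n (op_act Q n \<sigma> x) = op_act P n \<sigma> (\<psi> n x)"
      using operad_hom_act[OF hom closed] left[OF P.act_closed[OF _ closed]] right by metis
  qed (simp add: closed)
  moreover have "bij_betw (\<psi> n) (ops Q n) (ops P n)" for n
    unfolding \<psi>_def using bij by (rule bij_betw_inv_into)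
  ultimately show ?thesis
    using Q by (intro isomorphic_operads_bij)
qed

lemma isomorphic_operads_trans:
  assumes "isomorphic_operads P Q" "isomorphic_operads Q R"
  shows "isomorphic_operads P R"
proof -
  obtain \<phi> where P: "symmetric_operad P" and \<phi>: "operad_hom P Q \<phi>"
    and bij1: "\<And>n. bij_betw (\<phi> n) (ops P n) (ops Q n)"
    using assms by (auto simp: isomorphic_operads_def)
  obtain \<psi> where \<psi>: "operad_hom Q R \<psi>" and bij2: "\<And>n. bij_betw (\<psi> n) (ops Q n) (ops R n)"
    using assms by (auto simp: isomorphic_operads_def)
  have "operad_hom P R (\<lambda>n. \<psi> n \<circ> \<phi> n)"
    unfolding operad_hom_def
  proof (intro conjI allI ballI impI)
    fix x ys assume a: "x \<in> ops P (length ys) \<and> op_args P ys"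
    let ?zs = "map (\<lambda>(n, y). (n, \<phi> n y)) ys"
    have zs: "op_args Q ?zs" "length ?zs = length ys" "arity_sum ?zs = arity_sum ys"
      using a \<phi> by (auto simp: op_args_def operad_hom_def arity_sum_def comp_def case_prod_beta)
    have "\<phi> (length ys) x \<in> ops Q (length ys)"
      using a \<phi> by (simp add: operad_hom_def)
    then have "\<psi> (arity_sum ys) (op_comp Q (\<phi> (length ys) x) ?zs)
        = op_comp R (\<psi> (length ys) (\<phi> (length ys) x)) (map (\<lambda>(n, y). (n, \<psi> n y)) ?zs)"
      using zs by (intro operad_hom_comp[OF \<psi>]) auto
    then show "(\<psi> (arity_sum ys) \<circ> \<phi> (arity_sum ys)) (op_comp P x ys) =
        op_comp R ((\<psi> (length ys) \<circ> \<phi> (length ys)) x)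
          (map (\<lambda>(n, y). (n, (\<psi> n \<circ> \<phi> n) y)) ys)"
      using a operad_hom_comp[OF \<phi> refl refl, of x ys] by (simp add: comp_def case_prod_beta')
  qed (use \<phi> \<psi> in \<open>auto simp: operad_hom_def\<close>)
  moreover have "bij_betw (\<psi> n \<circ> \<phi> n) (ops P n) (ops R n)" for n
    using bij1 bij2 by (rule bij_betw_trans)
  ultimately show ?thesis
    by (rule isomorphic_operads_bij[OF P])
qed


section \<open>The operad of projections\<close>

text \<open>The number \<open>k\<close> in arity \<open>n\<close> stands for the operation that
  returns input \<open>k\<close>. Composition therefore looks only at block \<open>k\<close> and
  renumbers the input selected there; the action is \<sigma> itself because entry \<open>k\<close>
  of \<open>permute_list \<sigma> xs\<close> is \<open>xs ! \<sigma> k\<close>.\<close>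

definition proj_operad :: "nat operad" where
  "proj_operad =
     \<lparr>ops = (\<lambda>n. {..<n}),
      op_unit = 0,
      op_comp = (\<lambda>k ys. offset (map fst ys) k + snd (ys ! k)),
      op_act = (\<lambda>n \<sigma> k. \<sigma> k)\<rparr>"

lemma proj_operad_simps [simp]:
  "ops proj_operad n = {..<n}"
  "op_unit proj_operad = 0"
  "op_comp proj_operad k ys = offset (map fst ys) k + snd (ys ! k)"
  "op_act proj_operad n \<sigma> k = \<sigma> k"
  by (simp_all add: proj_operad_def)

lemma op_args_proj_operad:
  "op_args proj_operad ys \<longleftrightarrow> (\<forall>i < length ys. snd (ys ! i) < fst (ys ! i))"
  by (auto simp: op_args_def all_set_conv_all_nth case_prod_beta)

text \<open>Serves associativity: the operations preceding a given one in a concatenation are the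
  earlier lists in full and an initial piece of its own list.\<close>

lemma take_concat_offset:
  assumes "i < length zss" "j \<le> length (zss ! i)"
  shows "take (offset (map length zss) i + j) (concat zss) = concat (take i zss) @ take j (zss ! i)"
proof -
  have "concat zss = concat (take i zss) @ zss ! i @ concat (drop (Suc i) zss)"
    using assms by (metis concat.simps(2) concat_append id_take_nth_drop)
  moreover have "offset (map length zss) i = length (concat (take i zss))"
    by (simp add: offset_def length_concat take_map)
  ultimately show ?thesis
    using assms by simp
qed

lemma nth_concat_offset:
  assumes "i < length zss" "j < length (zss ! i)"
  shows "concat zss ! (offset (map length zss) i + j) = zss ! i ! j"
proof -
  have "concat zss = concat (take i zss) @ zss ! i @ concat (drop (Suc i) zss)"
    using assms by (metis concat.simps(2) concat_append id_take_nth_drop)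
  moreover have "offset (map length zss) i = length (concat (take i zss))"
    by (simp add: offset_def length_concat take_map)
  ultimately show ?thesis
    using assms by (simp add: nth_append)
qed

lemma symmetric_operad_proj_operad: "symmetric_operad proj_operad"
proof
  fix x ys assume "x \<in> ops proj_operad (length ys)" "op_args proj_operad ys"
  then show "op_comp proj_operad x ys \<in> ops proj_operad (arity_sum ys)"
    using offset_bound[of x "map fst ys" "snd (ys ! x)"]
    by (simp add: op_args_proj_operad arity_sum_def)
next
  fix x ys zss
  assume *: "x \<in> ops proj_operad (length ys)" "op_args proj_operad ys" "length zss = length ys"
    and zss: "\<And>i. i < length ys \<Longrightarrow> length (zss ! i) = fst (ys ! i) \<and> op_args proj_operad (zss ! i)"
  let ?y = "snd (ys ! x)"
  have x: "x < length zss" and y: "?y < length (zss ! x)"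
    using * zss by (auto simp: op_args_proj_operad)
  have len: "map fst ys = map length zss"
    using * zss by (auto intro: nth_equalityI)
  have "map fst (map2 (\<lambda>(n, y) zs. (arity_sum zs, op_comp proj_operad y zs)) ys zss)
      = map arity_sum zss"
    using * by (auto simp: case_prod_beta intro: nth_equalityI)
  \<comment> \<open>The selected operation has this index in \<open>concat zss\<close>. The arities
    before it add up to the totals of the lists before \<open>zss ! x\<close> plus the offset within
    \<open>zss ! x\<close>, which is the nested composite on the other side.\<close>
  moreover have "offset (map fst (concat zss)) (offset (map length zss) x + ?y)
      = offset (map arity_sum zss) x + offset (map fst (zss ! x)) ?y"
    using take_concat_offset[OF x, of ?y] y
    using arity_sum_concat[of "take x zss"]
    by (simp add: offset_def arity_sum_def take_map)
  ultimately show "op_comp proj_operad (op_comp proj_operad x ys) (concat zss) =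
      op_comp proj_operad x
        (map2 (\<lambda>(n, y) zs. (arity_sum zs, op_comp proj_operad y zs)) ys zss)"
    using x y * len by (simp add: nth_concat_offset case_prod_beta)
next
  fix x ys \<sigma> zs \<beta>
  assume "x \<in> ops proj_operad (length ys)" "op_args proj_operad ys"
    "\<sigma> permutes {..<length ys}" "zs = permute_list \<sigma> ys"
    "\<And>i j. \<lbrakk>i < length ys; j < fst (zs ! i)\<rbrakk>
      \<Longrightarrow> \<beta> (offset (map fst zs) i + j) = offset (map fst ys) (\<sigma> i) + j"
  moreover from this have "\<sigma> x < length ys"
    using permutes_in_image[of \<sigma> "{..<length ys}" x] by simp
  \<comment> \<open>Since \<open>zs ! x\<close> is \<open>ys ! \<sigma> x\<close>, this is the
    condition on \<beta> at \<open>i = x\<close> and \<open>j = snd (zs ! x)\<close>.\<close>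
  ultimately show "op_comp proj_operad (op_act proj_operad (length ys) \<sigma> x) ys
      = op_act proj_operad (arity_sum ys) \<beta> (op_comp proj_operad x zs)"
    by (simp add: op_args_proj_operad permute_list_nth)
next
  fix x ys \<theta> \<beta>
  assume "x \<in> ops proj_operad (length ys)" "op_args proj_operad ys"
    and "\<And>i j. \<lbrakk>i < length ys; j < fst (ys ! i)\<rbrakk>
      \<Longrightarrow> \<beta> (offset (map fst ys) i + j) = offset (map fst ys) i + \<theta> i j"
  moreover have "map fst (map (\<lambda>i. (fst (ys ! i), op_act proj_operad (fst (ys ! i)) (\<theta> i)
      (snd (ys ! i)))) [0..<length ys]) = map fst ys"
    by (auto intro: nth_equalityI)
  ultimately show "op_comp proj_operad x (map (\<lambda>i. (fst (ys ! i),
        op_act proj_operad (fst (ys ! i)) (\<theta> i) (snd (ys ! i)))) [0..<length ys])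
      = op_act proj_operad (arity_sum ys) \<beta> (op_comp proj_operad x ys)"
    by (simp add: op_args_proj_operad)
next
  fix \<sigma> n x assume "\<sigma> permutes {..<n}" "x \<in> ops proj_operad n"
  then show "op_act proj_operad n \<sigma> x \<in> ops proj_operad n"
    using permutes_in_image[of \<sigma> "{..<n}" x] by simp
qed (simp_all add: offset_def sum_list_replicate)


section \<open>Perm and the leftmost leaf\<close>

text \<open>The left-normed product \<open>((t x) y) ...\<close>. With a variable as
  \<open>t\<close> it is the normal form of a tree modulo the relations, up to the order of the
  list.\<close>

definition comb :: "'a magma \<Rightarrow> 'a list \<Rightarrow> 'a magma" where
  "comb t xs = foldl Mul t (map Var xs)"

lemma comb_simps [simp]:
  "comb t [] = t"
  "comb t (x # xs) = comb (Mul t (Var x)) xs"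
  "comb t (xs @ ys) = comb (comb t xs) ys"
  by (simp_all add: comb_def)

lemma leaves_comb: "leaves (comb t xs) = leaves t @ xs"
  by (induction xs arbitrary: t) auto

lemma leaves_nonempty [simp]: "leaves t \<noteq> []"
  by (induction t) auto

lemma perm_eq_comb: "perm_eq s t \<Longrightarrow> perm_eq (comb s xs) (comb t xs)"
  by (induction xs arbitrary: s t) (auto intro: perm_cong perm_refl)

text \<open>Associativity rewrites \<open>s(tu)\<close> to \<open>(st)u\<close>. The induction
  hypothesis for \<open>u\<close> then applies with \<open>st\<close> on the left, and the one for
  \<open>t\<close> with \<open>s\<close>, which is why \<open>s\<close> is arbitrary.\<close>

lemma perm_eq_Mul_comb: "perm_eq (Mul s t) (comb s (leaves t))"
proof (induction t arbitrary: s)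
  case (Mul t u)
  have "perm_eq (Mul s (Mul t u)) (Mul (Mul s t) u)"
    by (rule perm_sym, rule perm_assoc)
  moreover have "perm_eq (Mul (Mul s t) u) (comb (Mul s t) (leaves u))"
    by (rule Mul)
  ultimately have "perm_eq (Mul s (Mul t u)) (comb (Mul s t) (leaves u))"
    using perm_trans by blast
  moreover have "perm_eq (comb (Mul s t) (leaves u)) (comb (comb s (leaves t)) (leaves u))"
    by (rule perm_eq_comb) (rule Mul)
  ultimately show ?case
    using perm_trans by auto
qed (simp add: perm_refl)

text \<open>The normal form: the left factor is brought to it by induction, and the leaves of the
  right factor are appended by \<open>perm_eq_Mul_comb\<close>.\<close>

lemma perm_eq_comb_leaves: "perm_eq t (comb (Var (hd (leaves t))) (tl (leaves t)))"
proof (induction t)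
  case (Mul s t)
  have "perm_eq (Mul s t) (comb s (leaves t))"
    by (rule perm_eq_Mul_comb)
  moreover have "perm_eq (comb s (leaves t))
      (comb (comb (Var (hd (leaves s))) (tl (leaves s))) (leaves t))"
    by (rule perm_eq_comb) (rule Mul)
  ultimately show ?case
    using perm_trans by auto
qed (simp add: perm_refl)

text \<open>Adjacent entries commute, by \<open>(tz)x = t(zx) = t(xz) = (tx)z\<close>, so
  \<open>x\<close> can travel to the front of the list.\<close>

lemma perm_eq_comb_Cons: "perm_eq (comb t (xs @ x # ys)) (comb t (x # xs @ ys))"
proof (induction xs arbitrary: t)
  case (Cons z xs)
  have "perm_eq (Mul (Mul t (Var z)) (Var x)) (Mul (Mul t (Var x)) (Var z))"
    using perm_assoc perm_comm perm_sym perm_trans by metis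
  then have "perm_eq (comb (Mul (Mul t (Var z)) (Var x)) (xs @ ys))
      (comb (Mul (Mul t (Var x)) (Var z)) (xs @ ys))"
    by (rule perm_eq_comb)
  then show ?case
    using Cons[of "Mul t (Var z)"] perm_trans by auto
qed (simp add: perm_refl)

text \<open>The first entry of \<open>xs\<close> is located in \<open>ys\<close> and moved to its
  front; what remains is the same statement for shorter lists.\<close>

lemma perm_eq_comb_mset: "mset xs = mset ys \<Longrightarrow> perm_eq (comb t xs) (comb t ys)"
proof (induction xs arbitrary: t ys)
  case (Cons x xs)
  then have "x \<in> set ys"
    by (metis list.set_intros(1) mset_eq_setD)
  then obtain as bs where ys: "ys = as @ x # bs"
    by (meson split_list)
  then have "perm_eq (comb (Mul t (Var x)) xs) (comb (Mul t (Var x)) (as @ bs))"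
    using Cons by (intro Cons.IH) simp
  moreover have "perm_eq (comb t (x # as @ bs)) (comb t ys)"
    unfolding ys by (rule perm_sym, rule perm_eq_comb_Cons)
  ultimately show ?case
    using perm_trans by auto
qed (simp add: perm_refl)

lemma perm_eq_hd: "perm_eq s t \<Longrightarrow> hd (leaves s) = hd (leaves t)"
  by (induction rule: perm_eq.induct) auto

text \<open>Both relations keep the leftmost leaf and the multiset of leaves. Conversely, these two
  data determine the normal form up to the order of the entries after the first.\<close>

lemma perm_eq_iff:
  "perm_eq s t \<longleftrightarrow> hd (leaves s) = hd (leaves t) \<and> mset (leaves s) = mset (leaves t)"
proof (intro iffI; (elim conjE)?)
  assume hd: "hd (leaves s) = hd (leaves t)" and "mset (leaves s) = mset (leaves t)"
  moreover have "leaves s = hd (leaves s) # tl (leaves s)" "leaves t = hd (leaves t) # tl (leaves t)"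
    by simp_all
  ultimately have "mset (tl (leaves s)) = mset (tl (leaves t))"
    by (metis add_mset_add_mset_same_iff mset.simps(2))
  then have "perm_eq (comb (Var (hd (leaves s))) (tl (leaves s)))
      (comb (Var (hd (leaves t))) (tl (leaves t)))"
    unfolding hd by (rule perm_eq_comb_mset)
  then show "perm_eq s t"
    using perm_eq_comb_leaves perm_sym perm_trans by metis
qed (use perm_eq_hd perm_eq_mset in blast)

section \<open>Equivalence classes of multilinear trees\<close>

lemma multilinear_mset: "multilinear n t \<longleftrightarrow> mset (leaves t) = mset [0..<n]"
proof
  assume "multilinear n t"
  then show "mset (leaves t) = mset [0..<n]"
    using set_eq_iff_mset_eq_distinct[of "leaves t" "[0..<n]"]
    by (simp add: multilinear_def atLeast0LessThan)
next
  assume eq: "mset (leaves t) = mset [0..<n]"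
  show "multilinear n t"
    unfolding multilinear_def mset_eq_imp_distinct_iff[OF eq] mset_eq_setD[OF eq]
    by (simp add: atLeast0LessThan)
qed

text \<open>For \<open>k < n\<close> this is a full equivalence class, by
  \<open>perm_eq_iff\<close>. As a function of \<open>k\<close> it is the isomorphism from
  \<open>proj_operad\<close> to \<open>Perm\<close>, given without choosing representatives.\<close>

definition trees_with_head :: "nat \<Rightarrow> nat \<Rightarrow> nat magma set" where
  "trees_with_head n k = {t. multilinear n t \<and> hd (leaves t) = k}"

lemma perm_class_multilinear:
  "multilinear n t \<Longrightarrow> perm_class t = trees_with_head n (hd (leaves t))"
  by (auto simp: perm_class_def trees_with_head_def perm_eq_iff multilinear_mset)

text \<open>Nonemptiness of these classes yields injectivity of \<open>trees_with_head n\<close> on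
  the numbers below \<open>n\<close>, and representatives on which the structure of
  \<open>Perm\<close> can be computed.\<close>

lemma tree_with_head_exists:
  assumes "k < n"
  obtains t where "multilinear n t" "hd (leaves t) = k"
proof
  let ?t = "comb (Var k) (remove1 k [0..<n])"
  show "multilinear n ?t"
    using assms by (simp add: multilinear_mset leaves_comb)
  show "hd (leaves ?t) = k"
    by (simp add: leaves_comb)
qed

lemma multilinear_hd: "multilinear n t \<Longrightarrow> hd (leaves t) < n"
  using hd_in_set[OF leaves_nonempty[of t]] by (auto simp: multilinear_def)

section \<open>Leaves of a grafted tree\<close>

lemma leaves_subst: "leaves (subst f t) = concat (map (\<lambda>a. leaves (f a)) (leaves t))"
  by (induction t) auto

text \<open>Allows the leaves of the outer tree and of each grafted tree to be sorted independently
  when only multisets matter.\<close>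

lemma mset_concat_map_cong:
  assumes "mset xs = mset ys" "\<And>x. x \<in> set ys \<Longrightarrow> mset (f x) = mset (g x)"
  shows "mset (concat (map f xs)) = mset (concat (map g ys))"
proof -
  have "mset (concat (map h zs)) = \<Sum>\<^sub># (image_mset (\<lambda>x. mset (h x)) (mset zs))"
    for h :: "'a \<Rightarrow> 'b list" and zs
    by (induction zs) auto
  moreover have "image_mset (\<lambda>x. mset (f x)) (mset ys) = image_mset (\<lambda>x. mset (g x)) (mset ys)"
    using assms by (intro image_mset_cong) simp
  ultimately show ?thesis
    using assms by simp
qed

text \<open>Each renumbered block starts where the previous one ends, so together they form one
  interval.\<close>

lemma concat_offset_blocks:
  "k \<le> length ns \<Longrightarrow> concat (map (\<lambda>i. map (\<lambda>j. offset ns i + j) [0..<ns ! i]) [0..<k])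
    = [0..<offset ns k]"
proof (induction k)
  case (Suc k)
  then have "offset ns (Suc k) = offset ns k + ns ! k"
    by (simp add: offset_def take_Suc_conv_app_nth)
  moreover have "map (\<lambda>j. offset ns k + j) [0..<ns ! k] = [offset ns k..<offset ns k + ns ! k]"
    by (rule nth_equalityI) auto
  ultimately show ?case
    using Suc upt_add_eq_append[of 0 "offset ns k" "ns ! k"] by simp
qed (simp add: offset_def)

text \<open>After sorting all leaves, the leaves of the graft are the consecutive blocks of
  \<open>concat_offset_blocks\<close>.\<close>

lemma multilinear_graft:
  assumes "multilinear (length ns) t"
    and "\<And>i. i < length ns \<Longrightarrow> multilinear (ns ! i) (ts ! i)"
  shows "multilinear (sum_list ns) (graft ns t ts)"
proof -
  have "mset (leaves (graft ns t ts))
      = mset (concat (map (\<lambda>i. map (\<lambda>j. offset ns i + j) [0..<ns ! i]) [0..<length ns]))"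
    unfolding graft_def leaves_subst
    by (rule mset_concat_map_cong) (use assms in \<open>auto simp: multilinear_mset leaves_map\<close>)
  then show ?thesis
    using concat_offset_blocks[of "length ns" ns] by (simp add: multilinear_mset offset_def)
qed

text \<open>The leftmost leaf comes from the tree grafted onto the leftmost leaf of
  \<open>t\<close>. The resulting formula is the composition of \<open>proj_operad\<close>.\<close>

lemma hd_leaves_graft:
  "hd (leaves (graft ns t ts)) = offset ns (hd (leaves t)) + hd (leaves (ts ! hd (leaves t)))"
proof -
  have "hd (leaves (subst f t)) = hd (leaves (f (hd (leaves t))))" for f :: "nat \<Rightarrow> nat magma"
    by (induction t) (auto simp: leaves_subst)
  then show ?thesis
    by (simp add: graft_def leaves_map hd_map)
qed

lemma isomorphic_operads_proj_Perm: "isomorphic_operads proj_operad Perm"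
proof (rule isomorphic_operads_bij[OF symmetric_operad_proj_operad])
  show bij: "bij_betw (trees_with_head n) (ops proj_operad n) (ops Perm n)" for n
  proof (rule bij_betw_imageI)
    show "inj_on (trees_with_head n) (ops proj_operad n)"
    proof (rule inj_onI)
      fix k l assume "k \<in> ops proj_operad n" "trees_with_head n k = trees_with_head n l"
      \<comment> \<open>A tree with leftmost leaf \<open>k\<close> lies in the common set, so its
        leftmost leaf is also \<open>l\<close>.\<close>
      then show "k = l"
        using tree_with_head_exists[of k n] by (auto simp: trees_with_head_def)
    qed
    show "trees_with_head n ` ops proj_operad n = ops Perm n"
      by (auto simp: ops_Perm perm_class_multilinear multilinear_hd)
        (metis perm_class_multilinear tree_with_head_exists)
  qed
  show "operad_hom proj_operad Perm trees_with_head"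
    unfolding operad_hom_def
  proof (intro conjI allI ballI impI)
    fix n x assume "x \<in> ops proj_operad n"
    then show "trees_with_head n x \<in> ops Perm n"
      using bij bij_betwE by blast
  next
    have "perm_class (Var 0) = trees_with_head 1 0"
      using perm_class_multilinear[of 1 "Var 0"] by (simp add: multilinear_mset)
    then show "trees_with_head 1 (op_unit proj_operad) = op_unit Perm"
      by (simp add: Perm_def)
  next
    fix n \<sigma> x assume x: "x \<in> ops proj_operad n" and \<sigma>: "\<sigma> permutes {..<n}"
    then obtain t where t: "multilinear n t" "hd (leaves t) = x"
      using tree_with_head_exists by auto
    have "multilinear n (map_magma \<sigma> t)"
      using t \<sigma> by (auto simp: multilinear_def leaves_map distinct_map permutes_image
          intro: inj_on_subset[OF permutes_inj])
    then show "trees_with_head n (op_act proj_operad n \<sigma> x)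
        = op_act Perm n \<sigma> (trees_with_head n x)"
      using t perm_class_multilinear[of n t] perm_class_multilinear[of n "map_magma \<sigma> t"]
      using Perm_act[of n \<sigma> t] by (simp add: leaves_map hd_map)
  next
    fix x ys assume *: "x \<in> ops proj_operad (length ys) \<and> op_args proj_operad ys"
    define ns where "ns = map fst ys"
    have len: "length ns = length ys" and sum: "arity_sum ys = sum_list ns"
      by (simp_all add: ns_def arity_sum_def)
    obtain t where t: "multilinear (length ys) t" "hd (leaves t) = x"
      using * tree_with_head_exists by auto
    \<comment> \<open>Representatives are chosen for all inserted classes; composition in
      \<open>Perm\<close> then becomes a single graft.\<close>
    have "\<forall>i<length ys. \<exists>s. multilinear (ns ! i) s \<and> hd (leaves s) = snd (ys ! i)"
      using * by (auto simp: op_args_proj_operad ns_def intro: tree_with_head_exists)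
    then obtain s where s: "\<And>i. i < length ys \<Longrightarrow> multilinear (ns ! i) (s i)"
        "\<And>i. i < length ys \<Longrightarrow> hd (leaves (s i)) = snd (ys ! i)"
      by metis
    define ts where "ts = map s [0..<length ys]"
    have "map (\<lambda>(n, y). (n, trees_with_head n y)) ys = zip ns (map perm_class ts)"
      by (rule nth_equalityI)
        (use perm_class_multilinear[OF s(1)] s(2) in \<open>auto simp: ns_def ts_def case_prod_beta\<close>)
    then have "op_comp Perm (trees_with_head (length ys) x)
          (map (\<lambda>(n, y). (n, trees_with_head n y)) ys) = perm_class (graft ns t ts)"
      using Perm_comp[OF t(1) len, of ts] perm_class_multilinear[OF t(1)] t(2)
      by (simp add: ts_def)
    moreover have "multilinear (sum_list ns) (graft ns t ts)"
      by (rule multilinear_graft) (use t s len in \<open>simp_all add: ts_def\<close>)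
    ultimately show "trees_with_head (arity_sum ys) (op_comp proj_operad x ys)
        = op_comp Perm (trees_with_head (length ys) x)
          (map (\<lambda>(n, y). (n, trees_with_head n y)) ys)"
      using perm_class_multilinear * t s
      by (simp add: hd_leaves_graft sum ts_def) (simp add: ns_def)
  qed
qed


section \<open>Natural operations on sets\<close>

text \<open>Iterated products with a two-element set have unbounded finite cardinality, and subsets
  cut them down to size \<open>n\<close>.\<close>

lemma set_universe_distinct_list:
  assumes "set_universe U"
  obtains xs where "length xs = n" "distinct xs" "set xs \<in> U"
proof -
  have sub: "\<And>A B. A \<in> U \<Longrightarrow> B \<subseteq> A \<Longrightarrow> B \<in> U"
    and prod: "\<And>A B. A \<in> U \<Longrightarrow> B \<in> U \<Longrightarrow> \<exists>C \<in> U. C \<approx> A \<times> B"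
    using assms unfolding set_universe_def by blast+
  obtain T where T: "T \<in> U" "card T = 2"
    using assms[unfolded set_universe_def, THEN conjunct2, THEN conjunct2] by blast
  have "finite T"
    by (rule card_ge_0_finite) (simp add: T(2))
  have "\<exists>A \<in> U. finite A \<and> card A = 2 ^ Suc m" for m
  proof (induction m)
    case 0
    show ?case
      using T \<open>finite T\<close> by auto
  next
    case (Suc m)
    then obtain A where A: "A \<in> U" "finite A" "card A = 2 ^ Suc m" by blast
    obtain C where C: "C \<in> U" "C \<approx> A \<times> T"
      using prod A T by blast
    have "finite (A \<times> T)"
      using A \<open>finite T\<close> by simp
    then have "finite C" "card C = card (A \<times> T)"
      using C eqpoll_finite_iff eqpoll_iff_card by blast+
    then show ?case
      using C A T by (auto simp: card_cartesian_product)
  qed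
  then obtain A where A: "A \<in> U" "finite A" "card A = 2 ^ Suc n" by blast
  have "n < 2 ^ Suc n"
    using less_exp[of "Suc n"] by linarith
  then obtain B where B: "B \<subseteq> A" "card B = n"
    using obtain_subset_with_card_n[of n A] A by auto
  then obtain xs where "set xs = B" "distinct xs"
    using A finite_distinct_list finite_subset by metis
  then show thesis
    using that B sub A distinct_card by metis
qed

text \<open>Restricted in both arguments, so that it equals a transformation with extensional
  components as a HOL function.\<close>

definition projection :: "'u set set \<Rightarrow> nat \<Rightarrow> nat \<Rightarrow> 'u set \<Rightarrow> 'u list \<Rightarrow> 'u" where
  "projection U n k = (\<lambda>A \<in> U. \<lambda>xs \<in> tuples n A. xs ! k)"

lemma central_operad_Set_ops:
  "\<alpha> \<in> ops (central_operad_Set U) n \<longleftrightarrow>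
    \<alpha> \<in> (\<Pi>\<^sub>E A \<in> U. tuples n A \<rightarrow>\<^sub>E A) \<and>
    (\<forall>A \<in> U. \<forall>B \<in> U. \<forall>f \<in> A \<rightarrow>\<^sub>E B. \<forall>xs \<in> tuples n A. \<alpha> B (map f xs) = f (\<alpha> A xs))"
  by (simp add: central_operad_Set_def endo_operad_def power_nat_transfs_def set_cat_def id_func_def)

lemma projection_in_ops:
  assumes "k < n"
  shows "projection U n k \<in> ops (central_operad_Set U) n"
proof -
  have "map f xs \<in> tuples n B" if "f \<in> A \<rightarrow>\<^sub>E B" "xs \<in> tuples n A"
    for A B :: "'a set" and f xs
    using that by (auto simp: tuples_def)
  moreover have "xs ! k \<in> A" if "xs \<in> tuples n A" for A :: "'a set" and xs
    using that assms by (auto simp: tuples_def)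
  ultimately show ?thesis
    using assms by (auto simp: central_operad_Set_ops projection_def tuples_def)
qed

text \<open>This is the Yoneda argument: an \<open>n\<close>-element set represents the
  \<open>n\<close>-th power of the identity functor, its list of elements \<open>as\<close> is the
  universal tuple, and \<alpha> is determined by its value there.\<close>

lemma natural_operation_projection:
  assumes U: "set_universe U" and \<alpha>: "\<alpha> \<in> ops (central_operad_Set U) n"
  obtains k where "k < n" "\<alpha> = projection U n k"
proof -
  have \<alpha>_ext: "\<alpha> \<in> extensional U" and \<alpha>_in: "\<And>A. A \<in> U \<Longrightarrow> \<alpha> A \<in> tuples n A \<rightarrow>\<^sub>E A"
    and nat: "\<And>A B f xs. \<lbrakk>A \<in> U; B \<in> U; f \<in> A \<rightarrow>\<^sub>E B; xs \<in> tuples n A\<rbrakk>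
      \<Longrightarrow> \<alpha> B (map f xs) = f (\<alpha> A xs)"
    using \<alpha> by (auto simp: central_operad_Set_ops PiE_iff)
  obtain as where as: "length as = n" "distinct as" "set as \<in> U"
    using set_universe_distinct_list[OF U] by blast
  have as_tuple: "as \<in> tuples n (set as)"
    using as by (simp add: tuples_def)
  \<comment> \<open>The component is taken at the set of entries itself, which forces the value to
    be an entry. For \<open>n = 0\<close> this set is empty, so that there are no operations of
    arity 0.\<close>
  then have "\<alpha> (set as) as \<in> set as"
    using \<alpha>_in[OF as(3)] by auto
  then obtain k where k: "k < n" "\<alpha> (set as) as = as ! k"
    using as by (metis in_set_conv_nth)
  have "\<alpha> A xs = xs ! k" if A: "A \<in> U" and xs: "xs \<in> tuples n A" for A xs
  proof -
    \<comment> \<open>The map that sends the universal tuple \<open>as\<close> to \<open>xs\<close>;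
      it is well defined because \<open>as\<close> is distinct. Naturality along it carries the
      value \<open>as ! k\<close> to \<open>xs ! k\<close>.\<close>
    define f where "f = (\<lambda>a \<in> set as. xs ! (THE i. i < n \<and> as ! i = a))"
    have f: "f (as ! i) = xs ! i" if "i < n" for i
    proof -
      have "(THE j. j < n \<and> as ! j = as ! i) = i"
        using as that by (intro the_equality) (auto simp: nth_eq_iff_index_eq)
      then show ?thesis
        using as that by (simp add: f_def)
    qed
    have "f \<in> extensional (set as)"
      by (simp add: f_def)
    moreover have "f a \<in> A" if "a \<in> set as" for a
      using that xs as f nth_mem[of _ xs] by (fastforce simp: in_set_conv_nth[of a] tuples_def)
    ultimately have "f \<in> set as \<rightarrow>\<^sub>E A"
      by (simp add: PiE_iff)
    moreover have "map f as = xs"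
      using xs as f by (auto simp: tuples_def intro: nth_equalityI)
    ultimately show ?thesis
      using nat[OF as(3) A _ as_tuple, of f] k f by simp
  qed
  then have "\<alpha> = projection U n k"
    using \<alpha>_ext \<alpha>_in unfolding projection_def
    by (intro extensionalityI[of _ U])
      (auto simp: PiE_iff intro!: extensionalityI[of "\<alpha> _" "tuples n _"])
  with k that show thesis by blast
qed

lemma block_tuples:
  assumes "xs \<in> tuples (sum_list ns) A" "i < length ns"
  shows "block ns i xs \<in> tuples (ns ! i) A"
  using assms offset_length_block[of xs ns i]
  by (auto simp: tuples_def block_def dest: in_set_takeD in_set_dropD)

lemma isomorphic_operads_proj_central_operad_Set:
  assumes U: "set_universe U"
  shows "isomorphic_operads proj_operad (central_operad_Set U)"
proof (rule isomorphic_operads_bij[OF symmetric_operad_proj_operad])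
  show "bij_betw (projection U n) (ops proj_operad n) (ops (central_operad_Set U) n)" for n
  proof (rule bij_betw_imageI)
    show "inj_on (projection U n) (ops proj_operad n)"
    proof (rule inj_onI)
      fix k l assume kl: "k \<in> ops proj_operad n" "l \<in> ops proj_operad n"
        and eq: "projection U n k = projection U n l"
      obtain as where as: "length as = n" "distinct as" "set as \<in> U"
        using set_universe_distinct_list[OF U] by blast
      \<comment> \<open>Evaluation at a tuple of \<open>n\<close> distinct elements separates the
        projections.\<close>
      then have "as ! k = as ! l"
        using fun_cong[OF fun_cong[OF eq], of "set as" as] by (simp add: projection_def tuples_def)
      then show "k = l"
        using kl as by (simp add: nth_eq_iff_index_eq)
    qed
    show "projection U n ` ops proj_operad n = ops (central_operad_Set U) n"
    proof (intro equalityI subsetI)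
      fix \<alpha> assume "\<alpha> \<in> ops (central_operad_Set U) n"
      then obtain k where "k < n" "\<alpha> = projection U n k"
        using natural_operation_projection[OF U] by blast
      then show "\<alpha> \<in> projection U n ` ops proj_operad n"
        by simp
    qed (auto intro: projection_in_ops)
  qed
  show "operad_hom proj_operad (central_operad_Set U) (projection U)"
    unfolding operad_hom_def
  proof (intro conjI allI ballI impI)
    show "projection U 1 (op_unit proj_operad) = op_unit (central_operad_Set U)"
      by (auto simp: central_operad_Set_def endo_operad_def set_cat_def id_func_def projection_def
          tuples_def length_Suc_conv intro!: restrict_ext)
  next
    fix n \<sigma> x assume x: "x \<in> ops proj_operad n" and \<sigma>: "\<sigma> permutes {..<n}"
    have "permute_list \<sigma> xs \<in> tuples n A" "permute_list \<sigma> xs ! x = xs ! \<sigma> x"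
      if "xs \<in> tuples n A" for A :: "'a set" and xs
      using that \<sigma> x by (simp_all add: tuples_def permute_list_nth)
    then show "projection U n (op_act proj_operad n \<sigma> x)
        = op_act (central_operad_Set U) n \<sigma> (projection U n x)"
      unfolding central_operad_Set_def endo_operad_def set_cat_def id_func_def projection_def
      by (simp cong: restrict_cong)
  next
    fix x ys assume *: "x \<in> ops proj_operad (length ys) \<and> op_args proj_operad ys"
    define ns where "ns = map fst ys"
    define zs where "zs = map (\<lambda>(n, y). (n, projection U n y)) ys"
    have zs: "map fst zs = ns" "length zs = length ys" "arity_sum zs = arity_sum ys"
      "arity_sum ys = sum_list ns" "length ns = length ys"
      by (auto simp: zs_def ns_def arity_sum_def comp_def case_prod_beta)
    \<comment> \<open>\<open>val\<close> translates positions within a block to positions in the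
      whole tuple. By \<open>closed\<close> the block values form a tuple in \<open>A\<close>, so
      the restricted outer projection does not take its default value.\<close>
    have val: "snd (zs ! i) A (block ns i xs) = xs ! (offset ns i + snd (ys ! i))"
      and closed: "snd (zs ! i) A (block ns i xs) \<in> A"
      if "i < length ys" "A \<in> U" "xs \<in> tuples (sum_list ns) A" for i A xs
    proof -
      have y: "snd (ys ! i) < ns ! i"
        using * that by (simp add: op_args_proj_operad ns_def)
      have len: "offset ns i + snd (ys ! i) < length xs"
        using that y offset_bound[of i ns] zs by (simp add: tuples_def)
      then show "snd (zs ! i) A (block ns i xs) = xs ! (offset ns i + snd (ys ! i))"
        using that y block_tuples[of xs ns A i] zs
        by (simp add: zs_def case_prod_beta projection_def ns_def[symmetric])
          (simp add: ns_def projection_def block_def)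
      then show "snd (zs ! i) A (block ns i xs) \<in> A"
        using len that by (auto simp: tuples_def)
    qed
    show "projection U (arity_sum ys) (op_comp proj_operad x ys)
        = op_comp (central_operad_Set U) (projection U (length ys) x)
          (map (\<lambda>(n, y). (n, projection U n y)) ys)"
      unfolding zs_def[symmetric] using * val closed zs
      by (auto simp: central_operad_Set_def endo_operad_def set_cat_def id_func_def
          projection_def ns_def[symmetric] tuples_def[of "length ys"] intro!: restrict_ext)
  qed (simp add: projection_in_ops)
qed

theorem proposition7p4:
  fixes U :: "'u set set"
  assumes "set_universe U"
  shows "isomorphic_operads (central_operad_Set U) Perm"
  by (rule isomorphic_operads_trans[OF isomorphic_operads_sym])
    (rule isomorphic_operads_proj_central_operad_Set[OF assms], rule isomorphic_operads_proj_Perm)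

end
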